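(* Consider the post-model-selection testing problem in the Gaussian linear regression model with two regressors and known error variance $1$ described in the context, with model-selection cut-off $c>0$, test statistic $T_n(\alpha_0)$, and critical values $c_{n,\hat\beta_n(U)}(\delta)$ and $\hat c_{n,\eta,\min}(\delta)$. Suppose that $\rho_n=\rho$ for all $n>1$, where $\rho\neq 0$ does not depend on $n$, and let $0<\delta\le 1/2$ be arbitrary. Then $$\inf_{n>1}\ \sup_{\beta\in\mathbb{R}}P_{n,\alpha_0,\beta}\left(T_n(\alpha_0)>c_{n,\hat\beta_n(U)}(\delta)\right)>\delta .$$ Furthermore, for each fixed $\eta$ (not depending on $n$), $0<\eta<\delta$, that is sufficiently small (i.e., there is $\eta_0\in(0,\delta)$ such that for every $\eta\in(0,\eta_0)$), $$\inf_{n>1}\ \sup_{\beta\in\mathbb{R}}P_{n,\alpha_0,\beta}\left(T_n(\alpha_0)>\hat c_{n,\eta,\min}(\delta)\right)>\delta .$$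
   Context: Model. For each integer $n>1$ one observes $y_t=\alpha x_{t1}+\beta x_{t2}+\epsilon_t$, $1\le t\le n$, with $\alpha,\beta\in\mathbb{R}$, errors $\epsilon_t$ i.i.d. $N(0,1)$ (the error variance is known and equal to $1$), and a nonstochastic $n\times 2$ regressor matrix $X$ with rows $(x_{t1},x_{t2})$ that has full rank and satisfies $X'X/n\to Q$ as $n\to\infty$ with $Q$ positive definite. All quantities $y_t,x_{ti},\epsilon_t$ may depend on $n$. $P_{n,\alpha,\beta}$ denotes the distribution of the data under parameters $(\alpha,\beta)$. Write $$(X'X/n)^{-1}=\begin{pmatrix}\sigma_{\alpha,n}^2&\sigma_{\alpha,\beta,n}\\ \sigma_{\alpha,\beta,n}&\sigma_{\beta,n}^2\end{pmatrix},\qquad \rho_n=\frac{\sigma_{\alpha,\beta,n}}{\sigma_{\alpha,n}\sigma_{\beta,n}},$$ where $\sigma_{\alpha,n},\sigma_{\beta,n}>0$. Estimators and model selection. $\hat\alpha_n(U),\hat\beta_n(U)$ are the least-squares estimators of $\alpha,\beta$ in the unrestricted model $U$ (both regressors). $\hat\alpha_n(R)$ is the least-squares estimator of $\alpha$ in the restricted model $R$ that uses only the regressor $x_{t1}$ (i.e. imposes $\beta=0$). Fix $c>0$ independent of $n$. The selected model is $\hat M_n=U$ if $|\sqrt n\,\hat\beta_n(U)/\sigma_{\beta,n}|>c$, and $\hat M_n=R$ otherwise. Test statistic. For fixed $\alpha_0\in\mathbb{R}$, to test $H_0:\alpha=\alpha_0$ against $\alpha>\alpha_0$, $$T_n(\alpha_0)=\frac{n^{1/2}(\hat\alpha_n(R)-\alpha_0)}{\sigma_{\alpha,n}(1-\rho_n^2)^{1/2}}\,\mathbf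 1(\hat M_n=R)+\frac{n^{1/2}(\hat\alpha_n(U)-\alpha_0)}{\sigma_{\alpha,n}}\,\mathbf 1(\hat M_n=U).$$ Critical values. Let $H_{n,\beta}$ be the cumulative distribution function of $T_n(\alpha_0)$ under $P_{n,\alpha_0,\beta}$; it is continuous and strictly increasing on $\mathbb{R}$. For $0<v<1$ let $c_{n,\beta}(v)=H_{n,\beta}^{-1}(1-v)$. Then $c_{n,\hat\beta_n(U)}(\delta)$ is $c_{n,\beta}(\delta)$ evaluated at $\beta=\hat\beta_n(U)$. Let $c_{n,\sup}(\delta)=\sup_{\beta\in\mathbb{R}}c_{n,\beta}(\delta)$. For $0<\eta<\delta$ let $$I_n=\left[\hat\beta_n(U)-n^{-1/2}\sigma_{\beta,n}\Phi^{-1}(1-\eta/2),\ \hat\beta_n(U)+n^{-1/2}\sigma_{\beta,n}\Phi^{-1}(1-\eta/2)\right],$$ $c_{n,\eta,Loh}(\delta)=\sup_{\beta\in I_n}c_{n,\beta}(\delta-\eta)$, and $\hat c_{n,\eta,\min}(\delta)=\min\left(c_{n,\sup}(\delta),c_{n,\eta,Loh}(\delta)\right)$. Here $\Phi$ is the standard normal cumulative distribution function. *)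

theory Defs
  imports "HOL-Probability.Probability"
begin

text \<open>
  Everything below is for a single sample size \<open>n\<close>.  A design \<open>x :: nat \<Rightarrow> real^2\<close> lists the
  regressor rows \<open>x t = (x\<^sub>t\<^sub>1, x\<^sub>t\<^sub>2)\<close> and a data vector is a function \<open>y :: nat \<Rightarrow> real\<close>;
  both are only ever used at indices in \<open>{1..n}\<close>.  Parameters are vectors \<open>\<theta> = (\<alpha>, \<beta>)\<close>.
\<close>

definition positive_definite :: "real^2^2 \<Rightarrow> bool" where
  "positive_definite A \<longleftrightarrow> transpose A = A \<and> (\<forall>v. v \<noteq> 0 \<longrightarrow> v \<bullet> (A *v v) > 0)"

text \<open>Rank of the \<open>n \<times> 2\<close> matrix, as the dimension of its row space (as for the library's \<^const>\<open>rank\<close>,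
  which needs the number of rows to be a type).\<close>

definition design_rank :: "nat \<Rightarrow> (nat \<Rightarrow> real^2) \<Rightarrow> nat" where
  "design_rank n x = dim (x ` {1..n})"

definition scaled_gram :: "nat \<Rightarrow> (nat \<Rightarrow> real^2) \<Rightarrow> real^2^2" where
  "scaled_gram n x = (\<chi> i j. (\<Sum>t=1..n. x t $ i * x t $ j) / real n)"

definition sigma_alpha :: "nat \<Rightarrow> (nat \<Rightarrow> real^2) \<Rightarrow> real" where
  "sigma_alpha n x = sqrt (matrix_inv (scaled_gram n x) $ 1 $ 1)"

definition sigma_beta :: "nat \<Rightarrow> (nat \<Rightarrow> real^2) \<Rightarrow> real" where
  "sigma_beta n x = sqrt (matrix_inv (scaled_gram n x) $ 2 $ 2)"

definition rho :: "nat \<Rightarrow> (nat \<Rightarrow> real^2) \<Rightarrow> real" where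
  "rho n x = matrix_inv (scaled_gram n x) $ 1 $ 2 / (sigma_alpha n x * sigma_beta n x)"

definition rss :: "nat \<Rightarrow> (nat \<Rightarrow> real^2) \<Rightarrow> (nat \<Rightarrow> real) \<Rightarrow> real^2 \<Rightarrow> real" where
  "rss n x y \<theta> = (\<Sum>t=1..n. (y t - (\<theta> $ 1 * x t $ 1 + \<theta> $ 2 * x t $ 2))\<^sup>2)"

text \<open>Least-squares estimators as minimisers of the residual sum of squares; the minimisers are
  unique when the design has full rank.\<close>

definition ls_U :: "nat \<Rightarrow> (nat \<Rightarrow> real^2) \<Rightarrow> (nat \<Rightarrow> real) \<Rightarrow> real^2" where
  "ls_U n x y = (ARG_MIN (rss n x y) \<theta>. True)"

definition ls_R :: "nat \<Rightarrow> (nat \<Rightarrow> real^2) \<Rightarrow> (nat \<Rightarrow> real) \<Rightarrow> real^2" where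
  "ls_R n x y = (ARG_MIN (rss n x y) \<theta>. \<theta> $ 2 = 0)"

definition alpha_U :: "nat \<Rightarrow> (nat \<Rightarrow> real^2) \<Rightarrow> (nat \<Rightarrow> real) \<Rightarrow> real" where
  "alpha_U n x y = ls_U n x y $ 1"

definition beta_U :: "nat \<Rightarrow> (nat \<Rightarrow> real^2) \<Rightarrow> (nat \<Rightarrow> real) \<Rightarrow> real" where
  "beta_U n x y = ls_U n x y $ 2"

definition alpha_R :: "nat \<Rightarrow> (nat \<Rightarrow> real^2) \<Rightarrow> (nat \<Rightarrow> real) \<Rightarrow> real" where
  "alpha_R n x y = ls_R n x y $ 1"

definition selects_U :: "nat \<Rightarrow> (nat \<Rightarrow> real^2) \<Rightarrow> real \<Rightarrow> (nat \<Rightarrow> real) \<Rightarrow> bool" where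
  "selects_U n x c y \<longleftrightarrow> \<bar>sqrt (real n) * beta_U n x y / sigma_beta n x\<bar> > c"

definition T_stat :: "nat \<Rightarrow> (nat \<Rightarrow> real^2) \<Rightarrow> real \<Rightarrow> real \<Rightarrow> (nat \<Rightarrow> real) \<Rightarrow> real" where
  "T_stat n x c \<alpha>\<^sub>0 y =
     (sqrt (real n) * (alpha_R n x y - \<alpha>\<^sub>0) / (sigma_alpha n x * sqrt (1 - (rho n x)\<^sup>2)))
       * of_bool (\<not> selects_U n x c y)
   + (sqrt (real n) * (alpha_U n x y - \<alpha>\<^sub>0) / sigma_alpha n x) * of_bool (selects_U n x c y)"

text \<open>In the following, \<open>P \<alpha> \<beta>\<close> is the law of the data under the parameters \<open>(\<alpha>, \<beta>)\<close>.\<close>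

definition H_cdf :: "(real \<Rightarrow> real \<Rightarrow> (nat \<Rightarrow> real) measure) \<Rightarrow>
    nat \<Rightarrow> (nat \<Rightarrow> real^2) \<Rightarrow> real \<Rightarrow> real \<Rightarrow> real \<Rightarrow> real \<Rightarrow> real" where
  "H_cdf P n x c \<alpha>\<^sub>0 \<beta> = cdf (distr (P \<alpha>\<^sub>0 \<beta>) borel (T_stat n x c \<alpha>\<^sub>0))"

text \<open>Both \<^const>\<open>inv\<close>s below are applied to continuous, strictly increasing distribution functions
  at levels strictly between 0 and 1, so they yield the unique quantile.\<close>

definition crit :: "(real \<Rightarrow> real \<Rightarrow> (nat \<Rightarrow> real) measure) \<Rightarrow>
    nat \<Rightarrow> (nat \<Rightarrow> real^2) \<Rightarrow> real \<Rightarrow> real \<Rightarrow> real \<Rightarrow> real \<Rightarrow> real" where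
  "crit P n x c \<alpha>\<^sub>0 \<beta> v = inv (H_cdf P n x c \<alpha>\<^sub>0 \<beta>) (1 - v)"

definition std_normal_quantile :: "real \<Rightarrow> real" where
  "std_normal_quantile = inv (cdf std_normal_distribution)"

definition crit_sup :: "(real \<Rightarrow> real \<Rightarrow> (nat \<Rightarrow> real) measure) \<Rightarrow>
    nat \<Rightarrow> (nat \<Rightarrow> real^2) \<Rightarrow> real \<Rightarrow> real \<Rightarrow> real \<Rightarrow> real" where
  "crit_sup P n x c \<alpha>\<^sub>0 \<delta> = (SUP \<beta>. crit P n x c \<alpha>\<^sub>0 \<beta> \<delta>)"

definition conf_int :: "nat \<Rightarrow> (nat \<Rightarrow> real^2) \<Rightarrow> real \<Rightarrow> (nat \<Rightarrow> real) \<Rightarrow> real set" where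
  "conf_int n x \<eta> y =
     {beta_U n x y - sigma_beta n x / sqrt (real n) * std_normal_quantile (1 - \<eta> / 2) ..
      beta_U n x y + sigma_beta n x / sqrt (real n) * std_normal_quantile (1 - \<eta> / 2)}"

definition crit_Loh :: "(real \<Rightarrow> real \<Rightarrow> (nat \<Rightarrow> real) measure) \<Rightarrow>
    nat \<Rightarrow> (nat \<Rightarrow> real^2) \<Rightarrow> real \<Rightarrow> real \<Rightarrow> real \<Rightarrow> real \<Rightarrow> (nat \<Rightarrow> real) \<Rightarrow> real" where
  "crit_Loh P n x c \<alpha>\<^sub>0 \<eta> \<delta> y = (SUP \<beta>\<in>conf_int n x \<eta> y. crit P n x c \<alpha>\<^sub>0 \<beta> (\<delta> - \<eta>))"

definition crit_min :: "(real \<Rightarrow> real \<Rightarrow> (nat \<Rightarrow> real) measure) \<Rightarrow>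
    nat \<Rightarrow> (nat \<Rightarrow> real^2) \<Rightarrow> real \<Rightarrow> real \<Rightarrow> real \<Rightarrow> real \<Rightarrow> (nat \<Rightarrow> real) \<Rightarrow> real" where
  "crit_min P n x c \<alpha>\<^sub>0 \<eta> \<delta> y = min (crit_sup P n x c \<alpha>\<^sub>0 \<delta>) (crit_Loh P n x c \<alpha>\<^sub>0 \<eta> \<delta> y)"

end

theory Submission
  imports Defs
begin

text \<open>
  With \<open>g = sqrt n * \<beta> / \<sigma>\<^sub>\<beta>\<close> and \<open>s = sqrt (1 - \<rho>\<^sup>2)\<close>, the statistic has the law of
  \<open>W - \<rho> * g / s\<close> if \<open>\<bar>g + V\<bar> \<le> c\<close> and of \<open>\<rho> * V + s * W\<close> otherwise, for independent standard normal
  \<open>V\<close>, \<open>W\<close>, and \<open>g + V\<close> is the standardised estimator of \<open>\<beta>\<close>.  So nothing depends on \<open>n\<close>, and the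
  critical values are a quantile \<open>q g\<close> evaluated at \<open>g + V\<close>.  This quantile is continuous in \<open>g\<close> and tends
  to the quantile \<open>z\<close> of the unrestricted statistic as \<open>g\<close> goes to plus or minus infinity, but it exceeds \<open>z\<close>
  somewhere; hence it attains a maximum, at \<open>g\<^sub>m\<close> say, with \<open>q g\<^sub>m > z\<close>.  At the true value \<open>g\<^sub>m\<close> the constant
  critical value \<open>q g\<^sub>m\<close> gives size exactly \<open>\<delta>\<close>, whereas both random critical values never exceed
  \<open>q g\<^sub>m\<close> and lie strictly below it for all large \<open>g\<^sub>m + V\<close>.
\<close>

section \<open>Mixtures of normal distribution functions\<close>

abbreviation N01 :: "real measure" where
  "N01 \<equiv> std_normal_distribution"

abbreviation \<Phi> :: "real \<Rightarrow> real" where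
  "\<Phi> \<equiv> cdf std_normal_distribution"

interpretation N01: real_distribution N01
  by (rule real_dist_normal_dist)

text \<open>The normal density vanishes nowhere. Besides making \<Phi> strictly increasing, bounded
  intervals of positive mass make the integral comparisons below strict.\<close>

lemma emeasure_N01_Ioc_pos:
  assumes "a < b" shows "emeasure N01 {a<..b} > 0"
proof -
  have "emeasure N01 {a<..b} \<noteq> 0"
  proof
    assume "emeasure N01 {a<..b} = 0"
    then have "AE x in lborel. x \<notin> {a<..b}"
      by (simp add: emeasure_density nn_integral_0_iff_AE indicator_def normal_density_pos less_imp_neq[symmetric])
    then have "emeasure lborel {a<..b} = 0"
      by (subst (asm) AE_iff_measurable[OF _ refl]) (auto simp: Collect_conj_eq greaterThanAtMost_def greaterThan_def atMost_def)
    then show False using assms by simp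
  qed
  then show ?thesis by (simp add: zero_less_iff_neq_zero)
qed

lemma \<Phi>_strict_mono: "strict_mono \<Phi>"
proof (rule strict_monoI)
  fix a b :: real assume "a < b"
  then have "measure N01 {a<..b} > 0"
    using emeasure_N01_Ioc_pos[of a b] by (simp add: N01.emeasure_eq_measure)
  then show "\<Phi> a < \<Phi> b"
    using N01.cdf_diff_eq[OF \<open>a < b\<close>] by simp
qed

lemma isCont_\<Phi>: "isCont \<Phi> x"
proof -
  have "emeasure N01 {x} = 0"
    by (auto simp: emeasure_density nn_integral_0_iff_AE indicator_def intro: AE_mp[OF AE_lborel_singleton[of x]])
  then show ?thesis by (simp add: N01.isCont_cdf measure_def)
qed

lemma \<Phi>_measurable [measurable]: "\<Phi> \<in> borel_measurable borel"
  by (intro borel_measurable_continuous_onI continuous_at_imp_continuous_on ballI isCont_\<Phi>)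

lemma \<Phi>_less_iff [simp]: "\<Phi> a < \<Phi> b \<longleftrightarrow> a < b"
  by (rule strict_mono_less[OF \<Phi>_strict_mono])

lemma \<Phi>_le_iff [simp]: "\<Phi> a \<le> \<Phi> b \<longleftrightarrow> a \<le> b"
  by (rule strict_mono_less_eq[OF \<Phi>_strict_mono])

lemma measure_N01_greaterThan: "measure N01 {a<..} = 1 - \<Phi> a"
proof -
  have "measure N01 (- {..a}) = 1 - \<Phi> a"
    using N01.prob_compl[of "{..a}"] by (simp add: cdf_def2 Compl_eq_Diff_UNIV)
  then show ?thesis by (simp add: Compl_atMost)
qed

lemma nn_integral_N01_reflect:
  "f \<in> borel_measurable borel \<Longrightarrow> (\<integral>\<^sup>+ v. f (- v) \<partial>N01) = (\<integral>\<^sup>+ v. f v \<partial>N01)"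
  by (subst (2) nn_integral_density, simp, simp, subst nn_integral_real_affine[of _ "-1" 0])
     (auto simp: nn_integral_density normal_density_def)

lemma integral_N01_reflect:
  fixes f :: "real \<Rightarrow> real"
  assumes [measurable]: "f \<in> borel_measurable borel"
  shows "(\<integral> v. f (- v) \<partial>N01) = (\<integral> v. f v \<partial>N01)"
proof -
  have "distr N01 borel uminus = N01"
  proof (rule measure_eqI)
    fix A assume "A \<in> sets (distr N01 borel uminus)"
    then have [measurable]: "A \<in> sets borel" by simp
    have "(\<integral>\<^sup>+ v. indicator A (- v) \<partial>N01) = (\<integral>\<^sup>+ v. indicator A v \<partial>N01)"
      by (rule nn_integral_N01_reflect) simp
    then show "emeasure (distr N01 borel uminus) A = emeasure N01 A"
      by (simp flip: nn_integral_indicator add: nn_integral_distr)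
  qed simp
  then have "(\<integral> v. f v \<partial>N01) = (\<integral> v. f v \<partial>distr N01 borel uminus)" by simp
  then show ?thesis by (simp add: integral_distr)
qed

lemma \<Phi>_minus: "\<Phi> (- x) = 1 - \<Phi> x"
proof -
  have "(\<integral> v. (indicator {..x} (- v) :: real) \<partial>N01) = (\<integral> v. indicator {..x} v \<partial>N01)"
    using integral_N01_reflect[of "indicator {..x}"] by simp
  moreover have "(\<lambda>v. indicator {..x} (- v) :: real) = indicator {-x..}"
    by (auto simp: indicator_def fun_eq_iff)
  ultimately have "measure N01 {-x..} = \<Phi> x" by (simp add: cdf_def2)
  moreover have "measure N01 {-x} = 0" using isCont_\<Phi> N01.isCont_cdf by blast
  moreover have "measure N01 {-x..} = measure N01 {-x<..} + measure N01 {-x}"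
    by (subst N01.finite_measure_Union[symmetric]) (auto intro!: arg_cong[where f = "measure N01"])
  ultimately show ?thesis by (simp add: measure_N01_greaterThan)
qed

lemma \<Phi>_zero: "\<Phi> 0 = 1/2"
  using \<Phi>_minus[of 0] by simp

text \<open>Translation by \<open>d\<close> carries \<open>{m-d<..m}\<close> onto
  \<open>{m<..m+d}\<close>. As the latter lies left of 0, each of its points is no farther from 0
  than its preimage, so the density there is no smaller.\<close>

lemma \<Phi>_midpoint_convex:
  assumes "0 \<le> d" "m + d \<le> 0"
  shows "2 * \<Phi> m \<le> \<Phi> (m - d) + \<Phi> (m + d)"
proof (cases "d = 0")
  case False
  then have d: "d > 0" using assms by simp
  have "emeasure N01 {m-d<..m}
      = (\<integral>\<^sup>+ x. ennreal (std_normal_density x) * indicator {m-d<..m} x \<partial>lborel)"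
    by (simp add: emeasure_density)
  also have "\<dots> = (\<integral>\<^sup>+ x. ennreal (std_normal_density (x - d)) * indicator {m<..m+d} x \<partial>lborel)"
    by (subst nn_integral_real_affine[of _ 1 "-d"]) (auto intro!: nn_integral_cong simp: indicator_def add.commute)
  also have "\<dots> \<le> (\<integral>\<^sup>+ x. ennreal (std_normal_density x) * indicator {m<..m+d} x \<partial>lborel)"
  proof (intro nn_integral_mono, simp add: indicator_def, intro impI)
    fix x assume "m < x \<and> x \<le> m + d"
    then have "\<bar>x\<bar> \<le> \<bar>x - d\<bar>" using assms by auto
    then show "std_normal_density (x - d) \<le> std_normal_density x"
      by (simp add: normal_density_def abs_le_square_iff divide_right_mono)
  qed
  also have "\<dots> = emeasure N01 {m<..m+d}" by (simp add: emeasure_density)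
  finally have "measure N01 {m-d<..m} \<le> measure N01 {m<..m+d}"
    by (simp add: N01.emeasure_eq_measure)
  then show ?thesis
    using N01.cdf_diff_eq[of "m-d" m] N01.cdf_diff_eq[of m "m+d"] d by simp
qed simp

section \<open>Normal mixtures and their quantiles\<close>

lemma tendsto_integral_N01_at_top:
  fixes f :: "real \<Rightarrow> real \<Rightarrow> real"
  assumes "\<And>t. f t \<in> borel_measurable borel" "g \<in> borel_measurable borel"
    and "\<And>t v. \<bar>f t v\<bar> \<le> 1" "\<And>v. ((\<lambda>t. f t v) \<longlongrightarrow> g v) at_top"
  shows "((\<lambda>t. \<integral> v. f t v \<partial>N01) \<longlongrightarrow> (\<integral> v. g v \<partial>N01)) at_top"
  by (rule integral_dominated_convergence_at_top[where w = "\<lambda>_. 1"]) (use assms in auto)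

lemma integrable_N01_\<Phi> [simp]:
  assumes "f \<in> borel_measurable borel"
  shows "integrable N01 (\<lambda>v. \<Phi> (f v))"
  using assms by (intro N01.integrable_const_bound[where B = 1])
    (auto intro!: measurable_compose[OF _ \<Phi>_measurable] simp: N01.cdf_bounded_prob N01.cdf_nonneg)

text \<open>For \<open>a\<close> positive this is the distribution function of (Z - a-free shift
  \<open>b V\<close>) divided by \<open>a V\<close>, with Z and V independent standard
  normal.\<close>

definition mixture :: "(real \<Rightarrow> real) \<Rightarrow> (real \<Rightarrow> real) \<Rightarrow> real \<Rightarrow> real" where
  "mixture a b x = (\<integral> v. \<Phi> (a v * x + b v) \<partial>N01)"

lemma \<Phi>_abs_le: "\<bar>\<Phi> x\<bar> \<le> 1"
  by (simp add: N01.cdf_bounded_prob N01.cdf_nonneg)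

context
  fixes a b :: "real \<Rightarrow> real"
  assumes a [measurable]: "a \<in> borel_measurable borel" and b [measurable]: "b \<in> borel_measurable borel"
    and a_pos: "\<And>v. a v > 0"
begin

lemma mixture_strict_mono: "strict_mono (mixture a b)"
proof (rule strict_monoI)
  fix x y :: real assume "x < y"
  then show "mixture a b x < mixture a b y"
    unfolding mixture_def by (intro N01.integral_less_AE_space) (use N01.emeasure_space_1 in \<open>auto simp: a_pos\<close>)
qed

lemma isCont_mixture: "isCont (mixture a b) x"
  unfolding continuous_at_sequentially comp_def mixture_def
proof (intro allI impI, rule integral_dominated_convergence[where w = "\<lambda>_. 1"])
  fix X :: "nat \<Rightarrow> real" assume "X \<longlonglongrightarrow> x"
  then show "AE v in N01. (\<lambda>i. \<Phi> (a v * X i + b v)) \<longlonglongrightarrow> \<Phi> (a v * x + b v)"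
    by (intro AE_I2 isCont_tendsto_compose[OF isCont_\<Phi>] tendsto_intros)
qed (auto simp: \<Phi>_abs_le)

lemma mixture_at_top: "(mixture a b \<longlongrightarrow> 1) at_top"
proof -
  have "((\<lambda>t. \<integral> v. \<Phi> (a v * t + b v) \<partial>N01) \<longlongrightarrow> (\<integral> v. 1 \<partial>N01)) at_top"
  proof (rule tendsto_integral_N01_at_top)
    fix v
    have "filterlim (\<lambda>t. b v + a v * t) at_top at_top"
      by (intro filterlim_tendsto_add_at_top[OF tendsto_const]
          filterlim_tendsto_pos_mult_at_top[OF tendsto_const a_pos] filterlim_ident)
    then have "filterlim (\<lambda>t. a v * t + b v) at_top at_top" by (simp add: add.commute)
    then show "((\<lambda>t. \<Phi> (a v * t + b v)) \<longlongrightarrow> 1) at_top"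
      by (rule filterlim_compose[OF N01.cdf_lim_at_top_prob])
  qed (auto simp: \<Phi>_abs_le)
  then show ?thesis by (simp add: mixture_def[abs_def] N01.prob_space[simplified])
qed

lemma mixture_at_bot: "(mixture a b \<longlongrightarrow> 0) at_bot"
proof -
  have "((\<lambda>t. \<integral> v. \<Phi> (a v * (- t) + b v) \<partial>N01) \<longlongrightarrow> (\<integral> v. 0 \<partial>N01)) at_top"
  proof (rule tendsto_integral_N01_at_top)
    fix v
    have "filterlim (\<lambda>t. - b v + a v * t) at_top at_top"
      by (intro filterlim_tendsto_add_at_top[OF tendsto_const]
          filterlim_tendsto_pos_mult_at_top[OF tendsto_const a_pos] filterlim_ident)
    then have "filterlim (\<lambda>t. a v * (- t) + b v) at_bot at_top"
      by (simp add: filterlim_uminus_at_bot add.commute)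
    then show "((\<lambda>t. \<Phi> (a v * (- t) + b v)) \<longlongrightarrow> 0) at_top"
      by (rule filterlim_compose[OF N01.cdf_lim_at_bot])
  qed (auto simp: \<Phi>_abs_le)
  then show ?thesis by (simp add: mixture_def[abs_def] filterlim_at_bot_mirror)
qed

lemma mixture_attains:
  assumes "0 < p" "p < 1" shows "\<exists>x. mixture a b x = p"
proof -
  obtain u where u: "mixture a b u < p"
    using order_tendstoD(2)[OF mixture_at_bot assms(1)] by (auto simp: eventually_at_bot_linorder)
  obtain w where w: "p < mixture a b w"
    using order_tendstoD(1)[OF mixture_at_top assms(2)] by (auto simp: eventually_at_top_linorder)
  have "u < w" using u w strict_mono_less[OF mixture_strict_mono, of u w] by linarith
  then show ?thesis
    using IVT[of "mixture a b" u p w] u w isCont_mixture by auto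
qed

text \<open>\<open>inv\<close> is a choice of preimage, hence meaningful only because
  \<open>p\<close> is attained. The two equivalences let every later statement about quantiles be
  read off the distribution function at a fixed point.\<close>

lemma mixture_inv:
  assumes "0 < p" "p < 1"
  shows "mixture a b (inv (mixture a b) p) = p"
    and less_inv_mixture_iff: "x < inv (mixture a b) p \<longleftrightarrow> mixture a b x < p"
    and inv_mixture_less_iff: "inv (mixture a b) p < x \<longleftrightarrow> p < mixture a b x"
proof -
  show *: "mixture a b (inv (mixture a b) p) = p"
    using mixture_attains[OF assms] by (intro f_inv_into_f) auto
  show "x < inv (mixture a b) p \<longleftrightarrow> mixture a b x < p" "inv (mixture a b) p < x \<longleftrightarrow> p < mixture a b x"
    by (metis * strict_mono_less[OF mixture_strict_mono])+
qed

end

lemma \<Phi>_eq_mixture: "\<Phi> = mixture (\<lambda>_. 1) (\<lambda>_. 0)"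
  using N01.prob_space by (simp add: mixture_def[abs_def])

section \<open>The pre-test statistic as a function of two independent normals\<close>

text \<open>Change of measure: the exponential factor is the likelihood ratio of the normal law with
  mean \<open>g\<close> and variance 1 against the standard one.\<close>

lemma integral_N01_shift:
  fixes f :: "real \<Rightarrow> real"
  assumes [measurable]: "f \<in> borel_measurable borel"
  shows "(\<integral> v. f v \<partial>N01) = (\<integral> u. exp (u * g - g\<^sup>2 / 2) * f (u - g) \<partial>N01)"
proof -
  have "(\<integral> v. f v \<partial>N01) = (\<integral> v. std_normal_density v * f v \<partial>lborel)"
    by (subst integral_density) auto
  also have "\<dots> = (\<integral> u. std_normal_density (u - g) * f (u - g) \<partial>lborel)"
    by (subst lborel_integral_real_affine[of 1 _ "- g"]) (auto simp: add.commute)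
  also have "\<dots> = (\<integral> u. std_normal_density u * (exp (u * g - g\<^sup>2 / 2) * f (u - g)) \<partial>lborel)"
  proof (intro Bochner_Integration.integral_cong refl)
    fix u
    have "- (u - g)\<^sup>2 / 2 = - u\<^sup>2 / 2 + (u * g - g\<^sup>2 / 2)"
      by (simp add: power2_eq_square field_simps)
    then have "std_normal_density (u - g) = std_normal_density u * exp (u * g - g\<^sup>2 / 2)"
      by (simp add: std_normal_density_def mult_exp_exp)
    then show "std_normal_density (u - g) * f (u - g) = std_normal_density u * (exp (u * g - g\<^sup>2 / 2) * f (u - g))"
      by simp
  qed
  also have "\<dots> = (\<integral> u. exp (u * g - g\<^sup>2 / 2) * f (u - g) \<partial>N01)"
    by (subst integral_density) auto
  finally show ?thesis .
qed

locale pretest =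
  fixes c \<rho> :: real
  assumes c_pos: "c > 0" and \<rho>_nz: "\<rho> \<noteq> 0" and \<rho>_less_1: "\<bar>\<rho>\<bar> < 1"
begin

definition s :: real where "s = sqrt (1 - \<rho>\<^sup>2)"

text \<open>\<open>T g v w\<close> is the test statistic when \<open>g\<close> is the standardised \<open>\<beta>\<close>, \<open>g + v\<close> the pre-test statistic, and
  \<open>v\<close>, \<open>w\<close> are independent standard normal; \<open>scale\<close> and \<open>shift\<close> come from solving \<open>x < T g v w\<close> for \<open>w\<close>.\<close>

definition T :: "real \<Rightarrow> real \<Rightarrow> real \<Rightarrow> real" where
  "T g v w = (if \<bar>g + v\<bar> \<le> c then w - \<rho> * g / s else \<rho> * v + s * w)"

definition scale :: "real \<Rightarrow> real \<Rightarrow> real" where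
  "scale g v = (if \<bar>g + v\<bar> \<le> c then 1 else 1 / s)"

definition shift :: "real \<Rightarrow> real \<Rightarrow> real" where
  "shift g v = (if \<bar>g + v\<bar> \<le> c then \<rho> * g / s else - \<rho> * v / s)"

definition H :: "real \<Rightarrow> real \<Rightarrow> real" where
  "H g = mixture (scale g) (shift g)"

text \<open>The distribution function of the unrestricted statistic \<open>\<rho> * v + s * w\<close>.\<close>

definition H\<^sub>U :: "real \<Rightarrow> real" where
  "H\<^sub>U = mixture (\<lambda>_. 1 / s) (\<lambda>v. - \<rho> * v / s)"

definition q :: "real \<Rightarrow> real \<Rightarrow> real" where
  "q \<delta> g = inv (H g) (1 - \<delta>)"

lemma s_pos: "s > 0" and s_le_1: "s \<le> 1"
  using \<rho>_less_1 by (auto simp: s_def abs_square_less_1)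

lemma scale_pos: "scale g v > 0"
  using s_pos by (simp add: scale_def)

lemma measurable_scale [measurable]: "scale g \<in> borel_measurable borel"
  unfolding scale_def by measurable

lemma measurable_shift [measurable]: "shift g \<in> borel_measurable borel"
  unfolding shift_def by measurable

lemma measurable_T [measurable]: "(\<lambda>p. T g (fst p) (snd p)) \<in> borel_measurable (borel \<Otimes>\<^sub>M borel)"
  unfolding T_def by measurable

lemma less_T_iff: "x < T g v w \<longleftrightarrow> scale g v * x + shift g v < w"
  using s_pos by (auto simp: T_def scale_def shift_def field_simps)

lemma sets_N01_pair: "sets (N01 \<Otimes>\<^sub>M N01) = sets (borel \<Otimes>\<^sub>M borel)"
  by (intro sets_pair_measure_cong) auto

text \<open>Given \<open>v\<close>, the critical value \<open>k (g + v)\<close> is a constant and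
  rejection is a half-line event for \<open>w\<close>; Fubini then integrates a normal tail over
  \<open>v\<close>.\<close>

lemma measure_pair_less_T:
  assumes k [measurable]: "k \<in> borel_measurable borel"
  shows "measure (N01 \<Otimes>\<^sub>M N01) {p. k (g + fst p) < T g (fst p) (snd p)}
    = (\<integral> v. 1 - \<Phi> (scale g v * k (g + v) + shift g v) \<partial>N01)"
proof -
  let ?E = "{p. k (g + fst p) < T g (fst p) (snd p)}"
  have "{p \<in> space (borel \<Otimes>\<^sub>M borel). k (g + fst p) < T g (fst p) (snd p)} \<in> sets (borel \<Otimes>\<^sub>M borel)"
    by measurable
  then have E: "?E \<in> sets (N01 \<Otimes>\<^sub>M N01)"
    by (simp add: sets_N01_pair space_pair_measure)
  have "emeasure (N01 \<Otimes>\<^sub>M N01) ?E = (\<integral>\<^sup>+ v. emeasure N01 (Pair v -` ?E) \<partial>N01)"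
    by (rule N01.emeasure_pair_measure_alt[OF E])
  also have "\<dots> = (\<integral>\<^sup>+ v. ennreal (1 - \<Phi> (scale g v * k (g + v) + shift g v)) \<partial>N01)"
  proof (rule nn_integral_cong)
    fix v
    have "Pair v -` ?E = {scale g v * k (g + v) + shift g v <..}"
      by (auto simp: less_T_iff)
    then show "emeasure N01 (Pair v -` ?E) = ennreal (1 - \<Phi> (scale g v * k (g + v) + shift g v))"
      by (simp add: N01.emeasure_eq_measure measure_N01_greaterThan)
  qed
  also have "\<dots> = ennreal (\<integral> v. 1 - \<Phi> (scale g v * k (g + v) + shift g v) \<partial>N01)"
    by (rule nn_integral_eq_integral) (auto simp: N01.cdf_bounded_prob)
  finally have "emeasure (N01 \<Otimes>\<^sub>M N01) ?E = ennreal (\<integral> v. 1 - \<Phi> (scale g v * k (g + v) + shift g v) \<partial>N01)" .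
  moreover have "0 \<le> (\<integral> v. 1 - \<Phi> (scale g v * k (g + v) + shift g v) \<partial>N01)"
    by (intro integral_nonneg_AE AE_I2) (simp add: N01.cdf_bounded_prob)
  ultimately show ?thesis
    by (simp only: measure_def enn2real_ennreal)
qed

lemma pair_prob_N01: "prob_space (N01 \<Otimes>\<^sub>M N01)"
  using N01.prob_space_axioms by (rule prob_space_pair) (rule N01.prob_space_axioms)

lemma cdf_T: "cdf (distr (N01 \<Otimes>\<^sub>M N01) borel (\<lambda>p. T g (fst p) (snd p))) = H g"
proof
  fix x
  interpret P: prob_space "N01 \<Otimes>\<^sub>M N01" by (rule pair_prob_N01)
  have [measurable]: "(\<lambda>p. T g (fst p) (snd p)) \<in> borel_measurable (N01 \<Otimes>\<^sub>M N01)"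
    by (subst measurable_cong_sets[OF sets_N01_pair refl]) measurable
  have E: "{p \<in> space (N01 \<Otimes>\<^sub>M N01). x < T g (fst p) (snd p)} \<in> sets (N01 \<Otimes>\<^sub>M N01)"
    by measurable
  have "measure (N01 \<Otimes>\<^sub>M N01) {p \<in> space (N01 \<Otimes>\<^sub>M N01). x < T g (fst p) (snd p)} = 1 - H g x"
    using measure_pair_less_T[of "\<lambda>_. x" g] N01.prob_space
    by (simp add: H_def mixture_def space_pair_measure)
  then have "measure (N01 \<Otimes>\<^sub>M N01) {p \<in> space (N01 \<Otimes>\<^sub>M N01). \<not> x < T g (fst p) (snd p)} = H g x"
    by (simp add: P.prob_neg[OF E])
  then show "cdf (distr (N01 \<Otimes>\<^sub>M N01) borel (\<lambda>p. T g (fst p) (snd p))) x = H g x"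
    by (simp add: cdf_def2 measure_distr vimage_def Int_def not_less conj_commute)
qed

section \<open>The quantile as a function of the standardised parameter\<close>

lemma
  assumes "0 < \<delta>" "\<delta> < 1"
  shows H_q: "H g (q \<delta> g) = 1 - \<delta>"
    and less_q_iff: "x < q \<delta> g \<longleftrightarrow> H g x < 1 - \<delta>"
    and q_less_iff: "q \<delta> g < x \<longleftrightarrow> 1 - \<delta> < H g x"
  using mixture_inv[of "scale g" "shift g" "1 - \<delta>"] less_inv_mixture_iff[of "scale g" "shift g" "1 - \<delta>"]
    inv_mixture_less_iff[of "scale g" "shift g" "1 - \<delta>"] assms scale_pos
  by (auto simp: q_def H_def)

text \<open>\<open>scale\<close> and \<open>shift\<close> jump in \<open>g\<close> only where
  \<bar>g + v\<bar> = c. For fixed \<open>g\<close> this concerns just two values of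
  \<open>v\<close>, a null set, so dominated convergence applies.\<close>

lemma isCont_H: "isCont (\<lambda>g. H g x) g"
  unfolding continuous_at_sequentially comp_def H_def mixture_def
proof (intro allI impI, rule integral_dominated_convergence[where w = "\<lambda>_. 1"])
  fix G :: "nat \<Rightarrow> real" assume G: "G \<longlonglongrightarrow> g"
  have null: "AE v in N01. v \<noteq> a" for a
    by (subst AE_density) (auto intro: AE_mp[OF AE_lborel_singleton[of a]])
  show "AE v in N01. (\<lambda>i. \<Phi> (scale (G i) v * x + shift (G i) v)) \<longlonglongrightarrow> \<Phi> (scale g v * x + shift g v)"
    using null[of "c - g"] null[of "- c - g"]
  proof eventually_elim
    case (elim v)
    have lim: "(\<lambda>i. \<bar>G i + v\<bar>) \<longlonglongrightarrow> \<bar>g + v\<bar>" by (intro tendsto_intros G)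
    show ?case
    proof (cases "\<bar>g + v\<bar> < c")
      case True
      then have "\<forall>\<^sub>F i in sequentially. \<Phi> (x + \<rho> * G i / s) = \<Phi> (scale (G i) v * x + shift (G i) v)"
        using order_tendstoD(2)[OF lim True] by (auto elim!: eventually_mono simp: scale_def shift_def)
      moreover have "(\<lambda>i. \<Phi> (x + \<rho> * G i / s)) \<longlonglongrightarrow> \<Phi> (x + \<rho> * g / s)"
        using s_pos by (intro isCont_tendsto_compose[OF isCont_\<Phi>] tendsto_intros G) auto
      ultimately show ?thesis
        using True by (auto intro: Lim_transform_eventually simp: scale_def shift_def)
    next
      case False
      then have "\<bar>g + v\<bar> > c" using elim by auto
      then have "\<forall>\<^sub>F i in sequentially. \<Phi> (scale (G i) v * x + shift (G i) v) = \<Phi> (scale g v * x + shift g v)"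
        using order_tendstoD(1)[OF lim \<open>c < \<bar>g + v\<bar>\<close>] by (auto elim!: eventually_mono simp: scale_def shift_def)
      then show ?thesis by (rule tendsto_eventually)
    qed
  qed
qed (auto simp: \<Phi>_abs_le)

text \<open>For fixed \<open>v\<close> the unrestricted model is selected once \<bar>g\<bar> is
  large, so the integrand is eventually equal to that of \<open>H\<^sub>U\<close>.\<close>

lemma H_tendsto_H\<^sub>U: "((\<lambda>g. H g x) \<longlongrightarrow> H\<^sub>U x) at_top" "((\<lambda>g. H g x) \<longlongrightarrow> H\<^sub>U x) at_bot"
proof -
  have ev: "\<forall>\<^sub>F t in at_top. \<bar>t + v\<bar> > c" "\<forall>\<^sub>F t in at_top. \<bar>- t + v\<bar> > c" for v
    by (rule eventually_mono[OF eventually_gt_at_top[of "c + \<bar>v\<bar>"]]; simp)+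
  show "((\<lambda>g. H g x) \<longlongrightarrow> H\<^sub>U x) at_top"
    unfolding H_def H\<^sub>U_def mixture_def
  proof (rule tendsto_integral_N01_at_top)
    fix v show "((\<lambda>t. \<Phi> (scale t v * x + shift t v)) \<longlongrightarrow> \<Phi> (1 / s * x + - \<rho> * v / s)) at_top"
      using ev(1)[of v] by (intro tendsto_eventually) (auto elim!: eventually_mono simp: scale_def shift_def)
  qed (auto simp: \<Phi>_abs_le)
  have "((\<lambda>g. H (- g) x) \<longlongrightarrow> H\<^sub>U x) at_top"
    unfolding H_def H\<^sub>U_def mixture_def
  proof (rule tendsto_integral_N01_at_top)
    fix v show "((\<lambda>t. \<Phi> (scale (- t) v * x + shift (- t) v)) \<longlongrightarrow> \<Phi> (1 / s * x + - \<rho> * v / s)) at_top"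
      using ev(2)[of v] by (intro tendsto_eventually) (auto elim!: eventually_mono simp: scale_def shift_def)
  qed (auto simp: \<Phi>_abs_le)
  then show "((\<lambda>g. H g x) \<longlongrightarrow> H\<^sub>U x) at_bot"
    by (simp add: filterlim_at_bot_mirror)
qed

lemma H\<^sub>U_strict_mono: "strict_mono H\<^sub>U"
  unfolding H\<^sub>U_def by (rule mixture_strict_mono) (use s_pos in auto)

lemma isCont_H\<^sub>U: "isCont H\<^sub>U x"
  unfolding H\<^sub>U_def by (rule isCont_mixture) (use s_pos in auto)

text \<open>Reflecting \<open>v\<close> replaces \<Phi> by 1 - \<Phi>, so the integral equals one
  minus itself.\<close>

lemma H\<^sub>U_zero: "H\<^sub>U 0 = 1 / 2"
proof -
  have "(\<integral> v. \<Phi> (- \<rho> * v / s) \<partial>N01) = (\<integral> v. \<Phi> (- \<rho> * (- v) / s) \<partial>N01)"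
    by (rule integral_N01_reflect[symmetric, of "\<lambda>v. \<Phi> (- \<rho> * v / s)"]) simp
  also have "\<dots> = (\<integral> v. 1 - \<Phi> (- \<rho> * v / s) \<partial>N01)"
    by (simp add: \<Phi>_minus[symmetric])
  also have "\<dots> = 1 - (\<integral> v. \<Phi> (- \<rho> * v / s) \<partial>N01)"
    using N01.prob_space by simp
  finally show ?thesis by (simp add: H\<^sub>U_def mixture_def)
qed

text \<open>The bound \<delta> \<le> 1/2 puts \<open>z\<close> at or above the median 0; this sign
  is what \<open>H_less_H\<^sub>U\<close> asks for.\<close>

lemma H\<^sub>U_attains:
  assumes "0 < \<delta>" "\<delta> \<le> 1 / 2"
  obtains z where "H\<^sub>U z = 1 - \<delta>" "z \<ge> 0"
proof -
  obtain z where z: "H\<^sub>U z = 1 - \<delta>"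
    using mixture_attains[of "\<lambda>_. 1 / s" "\<lambda>v. - \<rho> * v / s" "1 - \<delta>"] assms s_pos
    by (auto simp: H\<^sub>U_def)
  then have "H\<^sub>U 0 \<le> H\<^sub>U z" using assms H\<^sub>U_zero by simp
  then have "z \<ge> 0" by (simp add: strict_mono_less_eq[OF H\<^sub>U_strict_mono])
  then show ?thesis using z that by blast
qed

text \<open>Comparing \<open>q \<delta>\<close> with \<open>a\<close> amounts to comparing
  \<open>H\<close> at the fixed point \<open>a\<close> with 1 - \<delta>, so continuity of
  \<open>H\<close> in \<open>g\<close> carries over to the quantile.\<close>

lemma isCont_q:
  assumes "0 < \<delta>" "\<delta> < 1"
  shows "isCont (q \<delta>) g"
  unfolding isCont_def
proof (rule order_tendstoI)
  have H: "((\<lambda>g. H g a) \<longlongrightarrow> H g a) (at g)" for a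
    using isCont_H[of g a] by (simp add: isCont_def)
  fix a
  show "\<forall>\<^sub>F x in at g. a < q \<delta> x" if "a < q \<delta> g"
    using order_tendstoD(2)[OF H[of a], of "1 - \<delta>"] that assms by (simp add: less_q_iff)
  show "\<forall>\<^sub>F x in at g. q \<delta> x < a" if "q \<delta> g < a"
    using order_tendstoD(1)[OF H[of a], of "1 - \<delta>"] that assms by (simp add: q_less_iff)
qed

lemma measurable_q [measurable]:
  assumes "0 < \<delta>" "\<delta> < 1"
  shows "q \<delta> \<in> borel_measurable borel"
  by (intro borel_measurable_continuous_onI continuous_at_imp_continuous_on ballI isCont_q assms)

lemma eventually_q_less:
  assumes "0 < \<delta>" "\<delta> < 1" "1 - \<delta> < H\<^sub>U a"
  shows "\<forall>\<^sub>F g in at_top. q \<delta> g < a" "\<forall>\<^sub>F g in at_bot. q \<delta> g < a"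
  using order_tendstoD(1)[OF H_tendsto_H\<^sub>U(1) assms(3)] order_tendstoD(1)[OF H_tendsto_H\<^sub>U(2) assms(3)]
    assms(1,2) by (simp_all add: q_less_iff)

text \<open>After recentring at the pre-test statistic \<open>u = g + v\<close> (which weights \<open>u\<close> by \<open>exp (u * g)\<close>), the
  contributions of \<open>u\<close> and \<open>- u\<close> to \<open>H\<^sub>U z - H g z\<close> add up to something positive.  The choice of \<open>g\<close>
  moves all arguments of \<open>\<Phi>\<close> to the half-line where it is convex.\<close>

lemma H_less_H\<^sub>U:
  assumes "z \<ge> 0"
  shows "H (- (z + \<bar>\<rho>\<bar> * c) / \<rho>) z < H\<^sub>U z"
proof -
  \<comment> \<open>With u = g + v, the term \<rho> * g / s cancels z / s in the unrestricted
    argument and leaves - B - \<rho> * u / s, which is at most 0 for \<bar>u\<bar> \<le> c. The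
    restricted argument becomes the constant \<kappa>.\<close>
  define g where "g = - (z + \<bar>\<rho>\<bar> * c) / \<rho>"
  define B where "B = \<bar>\<rho>\<bar> * c / s"
  define \<kappa> where "\<kappa> = z - z / s - B"
  define F where "F u = \<Phi> (- B - \<rho> * u / s) - \<Phi> \<kappa>" for u
  define h where "h u = (if \<bar>u\<bar> \<le> c then exp (u * g - g\<^sup>2 / 2) * F u else 0)" for u
  have \<rho>g: "\<rho> * g = - (z + \<bar>\<rho>\<bar> * c)" using \<rho>_nz by (simp add: g_def)
  have [measurable]: "F \<in> borel_measurable borel" unfolding F_def by measurable
  have [measurable]: "h \<in> borel_measurable borel" unfolding h_def by measurable
  \<comment> \<open>Here z \<ge> 0 and s \<le> 1 enter: \<kappa> lies at or below - B, the point
    about which u and - u place the unrestricted arguments symmetrically.\<close>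
  have "z \<le> z / s" using s_pos s_le_1 assms by (simp add: pos_le_divide_eq mult_left_le)
  then have \<kappa>: "\<kappa> \<le> - B" by (simp add: \<kappa>_def)
  have F_abs: "\<bar>F u\<bar> \<le> 1" for u
    unfolding F_def using N01.cdf_bounded_prob[of "- B - \<rho> * u / s"] N01.cdf_nonneg[of "- B - \<rho> * u / s"]
      N01.cdf_bounded_prob[of \<kappa>] N01.cdf_nonneg[of \<kappa>] by linarith
  have h_le: "norm (h u) \<le> exp (c * \<bar>g\<bar>)" for u
  proof -
    have "exp (u * g - g\<^sup>2 / 2) * \<bar>F u\<bar> \<le> exp (c * \<bar>g\<bar>) * 1" if "\<bar>u\<bar> \<le> c"
    proof (rule mult_mono)
      have "u * g \<le> \<bar>u\<bar> * \<bar>g\<bar>" by (simp add: abs_mult[symmetric])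
      also have "\<dots> \<le> c * \<bar>g\<bar>" using that by (intro mult_right_mono) auto
      finally have "u * g - g\<^sup>2 / 2 \<le> c * \<bar>g\<bar>" using zero_le_power2[of g] by linarith
      then show "exp (u * g - g\<^sup>2 / 2) \<le> exp (c * \<bar>g\<bar>)" by simp
    qed (use F_abs in auto)
    then show ?thesis by (simp add: h_def abs_mult)
  qed
  have int_h: "integrable N01 h"
    by (rule N01.integrable_const_bound[of _ "exp (c * \<bar>g\<bar>)"]) (use h_le in auto)
  have int_h': "integrable N01 (\<lambda>u. h (- u))"
    by (rule N01.integrable_const_bound[of _ "exp (c * \<bar>g\<bar>)"]) (use h_le[of "- u" for u] in auto)
  have "H\<^sub>U z - H g z = (\<integral> v. \<Phi> (1 / s * z + - \<rho> * v / s) - \<Phi> (scale g v * z + shift g v) \<partial>N01)"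
    unfolding H\<^sub>U_def H_def mixture_def by (subst Bochner_Integration.integral_diff) auto
  \<comment> \<open>Both integrands coincide wherever the pre-test selects the unrestricted
    model.\<close>
  also have "\<dots> = (\<integral> v. (if \<bar>g + v\<bar> \<le> c then F (g + v) else 0) \<partial>N01)"
  proof (intro Bochner_Integration.integral_cong refl)
    fix v
    have "1 / s * z + - \<rho> * v / s = - B - \<rho> * (g + v) / s"
      using \<rho>g s_pos by (simp add: B_def field_simps)
    moreover have "z + \<rho> * g / s = \<kappa>"
      using s_pos unfolding \<rho>g \<kappa>_def B_def by (simp add: field_simps)
    ultimately show "\<Phi> (1 / s * z + - \<rho> * v / s) - \<Phi> (scale g v * z + shift g v)
        = (if \<bar>g + v\<bar> \<le> c then F (g + v) else 0)"
      by (auto simp: scale_def shift_def F_def)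
  qed
  also have "\<dots> = (\<integral> u. h u \<partial>N01)"
    by (subst integral_N01_shift[where g = g]) (auto intro!: Bochner_Integration.integral_cong simp: h_def)
  finally have diff: "H\<^sub>U z - H g z = (\<integral> u. h u \<partial>N01)" .
  \<comment> \<open>On the side \<rho> * u < 0 the value \<open>F u\<close> is positive and its
    weight is the larger one. Hence the weighted sum splits into a positive multiple of
    \<open>F u\<close> plus a nonnegative multiple of \<open>F u + F (- u)\<close>, the latter being
    nonnegative by convexity.\<close>
  have pos': "h u + h (- u) > 0" if u: "\<bar>u\<bar> \<le> c" "\<rho> * u < 0" for u
  proof -
    have b: "\<bar>\<rho> * u / s\<bar> \<le> B"
      using u s_pos by (simp add: B_def abs_mult divide_right_mono mult_left_mono)
    have "\<Phi> (- B - b) + \<Phi> (- B + b) = \<Phi> (- B - \<bar>b\<bar>) + \<Phi> (- B + \<bar>b\<bar>)" for b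
      by (cases "b \<ge> 0") auto
    from this[of "\<rho> * u / s"] have "F u + F (- u) = \<Phi> (- B - \<bar>\<rho> * u / s\<bar>) + \<Phi> (- B + \<bar>\<rho> * u / s\<bar>) - 2 * \<Phi> \<kappa>"
      by (simp add: F_def del: abs_divide abs_mult)
    moreover have "2 * \<Phi> (- B) \<le> \<Phi> (- B - \<bar>\<rho> * u / s\<bar>) + \<Phi> (- B + \<bar>\<rho> * u / s\<bar>)"
      by (rule \<Phi>_midpoint_convex) (use b in auto)
    moreover have "\<Phi> \<kappa> \<le> \<Phi> (- B)" using \<kappa> by simp
    ultimately have sum: "F u + F (- u) \<ge> 0" by linarith
    have "\<rho> * u / s < 0" using u s_pos by (intro divide_neg_pos)
    then have F: "F u > 0" unfolding F_def using \<kappa> by simp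
    have "z + \<bar>\<rho>\<bar> * c > 0" using assms c_pos \<rho>_nz by (intro add_nonneg_pos mult_pos_pos) auto
    then have "\<rho> * g < 0" unfolding \<rho>g by simp
    \<comment> \<open>Both factors are negative; dividing by the square of \<rho> gives u * g > 0
      without a case distinction on the sign of \<rho>.\<close>
    then have "(\<rho> * u) * (\<rho> * g) > 0" using u(2) by (rule mult_neg_neg[rotated])
    then have "\<rho>\<^sup>2 * (u * g) > 0" by (simp add: power2_eq_square algebra_simps)
    then have "u * g > 0" using \<rho>_nz by (simp add: zero_less_mult_iff)
    then have "exp (- u * g - g\<^sup>2 / 2) < exp (u * g - g\<^sup>2 / 2)" by (simp add: mult.commute)
    then have "0 < (exp (u * g - g\<^sup>2 / 2) - exp (- u * g - g\<^sup>2 / 2)) * F u + exp (- u * g - g\<^sup>2 / 2) * (F u + F (- u))"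
      using F sum by (intro add_pos_nonneg mult_pos_pos mult_nonneg_nonneg) auto
    then show ?thesis using u by (simp add: h_def algebra_simps)
  qed
  have pos: "h u + h (- u) > 0" if "\<bar>u\<bar> \<le> c" "u \<noteq> 0" for u
    using pos'[of u] pos'[of "- u"] that \<rho>_nz by (cases "\<rho> * u" "0::real" rule: linorder_cases) auto
  have nonneg: "h u + h (- u) \<ge> 0" for u
  proof (cases "\<bar>u\<bar> \<le> c \<and> u \<noteq> 0")
    case False
    \<comment> \<open>What remains is \<bar>u\<bar> > c, where \<open>h\<close> vanishes at u and -
      u, and u = 0, where \<kappa> may equal - B and only the weak inequality holds.\<close>
    moreover have "F 0 \<ge> 0" using \<kappa> by (simp add: F_def)
    ultimately show ?thesis by (auto simp: h_def)
  qed (use pos[of u] in auto)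
  have "(\<integral> u. 0 \<partial>N01) < (\<integral> u. h u + h (- u) \<partial>N01)"
  proof (rule N01.integral_less_AE)
    show "emeasure N01 {0<..c} \<noteq> 0" using emeasure_N01_Ioc_pos[OF c_pos] by simp
    show "AE u in N01. u \<in> {0<..c} \<longrightarrow> 0 \<noteq> h u + h (- u)"
      using pos by (intro AE_I2 impI less_imp_neq) auto
  qed (use nonneg int_h int_h' in auto)
  also have "(\<integral> u. h u + h (- u) \<partial>N01) = 2 * (\<integral> u. h u \<partial>N01)"
    using int_h int_h' integral_N01_reflect[of h] by simp
  finally show ?thesis using diff by (simp add: g_def)
qed

text \<open>A level strictly between \<open>z\<close> and \<open>q \<delta> g1\<close> bounds the
  quantile outside a compact interval, so the maximum over that interval is global. The second
  conclusion says that the maximum exceeds \<open>z\<close>, in the form used by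
  \<open>eventually_q_less\<close>.\<close>

lemma q_attains_max:
  assumes "0 < \<delta>" "\<delta> \<le> 1 / 2"
  obtains g where "\<And>g'. q \<delta> g' \<le> q \<delta> g" "1 - \<delta> < H\<^sub>U (q \<delta> g)"
proof -
  have d: "0 < \<delta>" "\<delta> < 1" using assms by auto
  obtain z where z: "H\<^sub>U z = 1 - \<delta>" "z \<ge> 0" by (rule H\<^sub>U_attains[OF assms])
  define g1 where "g1 = - (z + \<bar>\<rho>\<bar> * c) / \<rho>"
  have g1: "z < q \<delta> g1" unfolding less_q_iff[OF d] using H_less_H\<^sub>U[OF z(2)] z(1) by (simp add: g1_def)
  define a where "a = (z + q \<delta> g1) / 2"
  have a: "z < a" "a < q \<delta> g1" using g1 by (auto simp: a_def)
  have "1 - \<delta> < H\<^sub>U a" using a(1) z(1) strict_monoD[OF H\<^sub>U_strict_mono, of z a] by simp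
  then obtain K K' where K: "\<And>g. g \<ge> K \<Longrightarrow> q \<delta> g < a" and K': "\<And>g. g \<le> K' \<Longrightarrow> q \<delta> g < a"
    using eventually_q_less[OF d, of a] by (auto simp: eventually_at_top_linorder eventually_at_bot_linorder)
  \<comment> \<open>The \<open>min\<close> and \<open>max\<close> with \<open>g1\<close> guarantee
    that the interval contains \<open>g1\<close>, whose value beats everything outside.\<close>
  let ?I = "{min K' g1..max K g1}"
  have "continuous_on ?I (q \<delta>)"
    by (intro continuous_at_imp_continuous_on ballI isCont_q d)
  then obtain g where g: "g \<in> ?I" "\<And>g'. g' \<in> ?I \<Longrightarrow> q \<delta> g' \<le> q \<delta> g"
    using continuous_attains_sup[of ?I "q \<delta>"] by (metis atLeastAtMost_iff compact_Icc empty_iff max.cobounded2 min.cobounded2)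
  have max: "q \<delta> g' \<le> q \<delta> g" for g'
  proof (cases "g' \<in> ?I")
    case False
    then have "q \<delta> g' < a" using K[of g'] K'[of g'] by auto
    also have "a < q \<delta> g1" by (rule a(2))
    also have "q \<delta> g1 \<le> q \<delta> g" by (rule g(2)) auto
    finally show ?thesis by simp
  qed (rule g(2))
  have "z < q \<delta> g" using g1 max[of g1] by linarith
  then have "1 - \<delta> < H\<^sub>U (q \<delta> g)" using z(1) strict_monoD[OF H\<^sub>U_strict_mono, of z "q \<delta> g"] by simp
  then show ?thesis using that max by blast
qed

text \<open>The constant critical value \<open>q \<delta> g\<close> rejects with probability exactly
  \<delta> at \<open>g\<close>. Lowering it weakly everywhere and strictly on a half-line enlarges
  the integrand on a set of positive mass, since \<open>scale\<close> is positive.\<close>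

lemma rejection_prob_gt:
  assumes d: "0 < \<delta>" "\<delta> < 1" and k [measurable]: "k \<in> borel_measurable borel"
    and le: "\<And>g'. k g' \<le> q \<delta> g" and less: "\<And>g'. g' \<ge> G \<Longrightarrow> k g' < q \<delta> g"
  shows "\<delta> < measure (N01 \<Otimes>\<^sub>M N01) {p. k (g + fst p) < T g (fst p) (snd p)}"
proof -
  have "\<delta> = 1 - H g (q \<delta> g)" using H_q[OF d] by simp
  also have "\<dots> = (\<integral> v. 1 - \<Phi> (scale g v * q \<delta> g + shift g v) \<partial>N01)"
    using N01.prob_space by (simp add: H_def mixture_def)
  also have "\<dots> < (\<integral> v. 1 - \<Phi> (scale g v * k (g + v) + shift g v) \<partial>N01)"
  proof (rule N01.integral_less_AE)
    \<comment> \<open>On this interval g + v exceeds \<open>G\<close>; its length 1 is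
      arbitrary.\<close>
    show "emeasure N01 {G - g<..G - g + 1} \<noteq> 0" using emeasure_N01_Ioc_pos[of "G - g" "G - g + 1"] by simp
    show "AE v in N01. v \<in> {G - g<..G - g + 1} \<longrightarrow>
        1 - \<Phi> (scale g v * q \<delta> g + shift g v) \<noteq> 1 - \<Phi> (scale g v * k (g + v) + shift g v)"
    proof (intro AE_I2 impI less_imp_neq)
      fix v assume "v \<in> {G - g<..G - g + 1}"
      then have "k (g + v) < q \<delta> g" by (intro less) auto
      then show "1 - \<Phi> (scale g v * q \<delta> g + shift g v) < 1 - \<Phi> (scale g v * k (g + v) + shift g v)"
        using scale_pos[of g v] by simp
    qed
  qed (use scale_pos[of g] le in \<open>auto intro!: mult_left_mono less_imp_le\<close>)
  also have "\<dots> = measure (N01 \<Otimes>\<^sub>M N01) {p. k (g + fst p) < T g (fst p) (snd p)}"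
    by (rule measure_pair_less_T[symmetric]) simp
  finally show ?thesis .
qed

section \<open>The windowed supremum and the two strict bounds for the standardised problem\<close>

definition loh :: "real \<Rightarrow> real \<Rightarrow> real \<Rightarrow> real" where
  "loh w \<delta> g = (SUP g'\<in>{g - w..g + w}. q \<delta> g')"

lemma bdd_above_q:
  assumes "0 < \<delta>" "\<delta> \<le> 1 / 2"
  shows "bdd_above (q \<delta> ` A)"
  using q_attains_max[OF assms] by (metis bdd_above.I2)

text \<open>A supremum of translates of a continuous function is lower semicontinuous: its strict
  superlevel sets are unions of open sets, so the uncountable index set does no harm.\<close>

lemma measurable_loh:
  assumes "0 < \<delta>" "\<delta> \<le> 1 / 2" "w \<ge> 0"
  shows "loh w \<delta> \<in> borel_measurable borel"
proof (rule borel_measurableI_greater)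
  fix a
  have "{g. a < loh w \<delta> g} = (\<Union>u\<in>{- w..w}. {g. a < q \<delta> (g + u)})"
  proof -
    have "a < loh w \<delta> g \<longleftrightarrow> (\<exists>u\<in>{- w..w}. a < q \<delta> (g + u))" for g
    proof -
      have "a < loh w \<delta> g \<longleftrightarrow> (\<exists>g'\<in>{g - w..g + w}. a < q \<delta> g')"
        unfolding loh_def using assms by (intro less_cSUP_iff bdd_above_q) auto
      also have "\<dots> \<longleftrightarrow> (\<exists>u\<in>{- w..w}. a < q \<delta> (g + u))"
      proof
        assume "\<exists>g'\<in>{g - w..g + w}. a < q \<delta> g'"
        then obtain g' where "g' \<in> {g - w..g + w}" "a < q \<delta> g'" by blast
        then show "\<exists>u\<in>{- w..w}. a < q \<delta> (g + u)" by (intro bexI[of _ "g' - g"]) auto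
      next
        assume "\<exists>u\<in>{- w..w}. a < q \<delta> (g + u)"
        then obtain u where "u \<in> {- w..w}" "a < q \<delta> (g + u)" by blast
        then show "\<exists>g'\<in>{g - w..g + w}. a < q \<delta> g'" by (intro bexI[of _ "g + u"]) auto
      qed
      finally show ?thesis .
    qed
    then show ?thesis by blast
  qed
  moreover have "open {g. a < q \<delta> (g + u)}" for u
  proof (intro open_Collect_less continuous_intros)
    have "continuous_on UNIV (q \<delta>)"
      using assms by (intro continuous_at_imp_continuous_on ballI isCont_q) auto
    then show "continuous_on UNIV (\<lambda>g. q \<delta> (g + u))"
      by (rule continuous_on_compose2) (auto intro!: continuous_intros)
  qed
  ultimately show "{g \<in> space borel. a < loh w \<delta> g} \<in> sets borel"
    by (auto intro!: borel_open)
qed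

lemma plug_in_rejection_prob_gt:
  assumes "0 < \<delta>" "\<delta> \<le> 1 / 2"
  obtains g where "\<delta> < measure (N01 \<Otimes>\<^sub>M N01) {p. q \<delta> (g + fst p) < T g (fst p) (snd p)}"
proof -
  have d: "0 < \<delta>" "\<delta> < 1" using assms by auto
  obtain g where g: "\<And>g'. q \<delta> g' \<le> q \<delta> g" "1 - \<delta> < H\<^sub>U (q \<delta> g)"
    using q_attains_max[OF assms] by blast
  obtain G where G: "\<And>g'. g' \<ge> G \<Longrightarrow> q \<delta> g' < q \<delta> g"
    using eventually_q_less(1)[OF d g(2)] by (auto simp: eventually_at_top_linorder)
  have "\<delta> < measure (N01 \<Otimes>\<^sub>M N01) {p. q \<delta> (g + fst p) < T g (fst p) (snd p)}"
    using d by (intro rejection_prob_gt G g) auto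
  then show ?thesis by (rule that)
qed

text \<open>For small \<eta> the limiting quantile at level \<delta> - \<eta> still lies below the
  maximum of \<open>q \<delta>\<close>, so windows far to the right have a smaller supremum. Neither
  \<open>\<eta>\<^sub>0\<close> nor \<open>g\<close> depends on the half-width
  \<open>w\<close>.\<close>

lemma min_rejection_prob_gt:
  assumes "0 < \<delta>" "\<delta> \<le> 1 / 2"
  obtains \<eta>\<^sub>0 g where "0 < \<eta>\<^sub>0" "\<eta>\<^sub>0 < \<delta>"
    "\<And>\<eta> w. 0 < \<eta> \<Longrightarrow> \<eta> < \<eta>\<^sub>0 \<Longrightarrow> 0 \<le> w \<Longrightarrow> \<delta> < measure (N01 \<Otimes>\<^sub>M N01)
        {p. min (SUP g'. q \<delta> g') (loh w (\<delta> - \<eta>) (g + fst p)) < T g (fst p) (snd p)}"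
proof -
  have d: "0 < \<delta>" "\<delta> < 1" using assms by auto
  obtain g where g: "\<And>g'. q \<delta> g' \<le> q \<delta> g" "1 - \<delta> < H\<^sub>U (q \<delta> g)"
    using q_attains_max[OF assms] by blast
  have sup: "(SUP g'. q \<delta> g') = q \<delta> g"
    by (rule cSup_eq_maximum) (use g(1) in auto)
  \<comment> \<open>The first term keeps \<delta> - \<eta> positive; the second is the excess of
    \<open>H\<^sub>U\<close> at the maximum over 1 - \<delta>, so that 1 - (\<delta> - \<eta>) stays
    below that value.\<close>
  define \<eta>\<^sub>0 where "\<eta>\<^sub>0 = min (\<delta> / 2) (H\<^sub>U (q \<delta> g) - (1 - \<delta>))"
  show ?thesis
  proof (rule that[of \<eta>\<^sub>0 g])
    show "0 < \<eta>\<^sub>0" "\<eta>\<^sub>0 < \<delta>" using d g(2) by (auto simp: \<eta>\<^sub>0_def)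
    fix \<eta> w :: real assume \<eta>: "0 < \<eta>" "\<eta> < \<eta>\<^sub>0" and w: "0 \<le> w"
    have d': "0 < \<delta> - \<eta>" "\<delta> - \<eta> \<le> 1 / 2" "\<delta> - \<eta> < 1" using \<eta> assms by (auto simp: \<eta>\<^sub>0_def)
    have "1 - (\<delta> - \<eta>) < H\<^sub>U (q \<delta> g)" using \<eta>(2) by (auto simp: \<eta>\<^sub>0_def)
    \<comment> \<open>A supremum over a window inherits only a weak bound. An intermediate level
      \<open>a\<close> strictly below the maximum keeps the final inequality strict.\<close>
    then have "\<forall>\<^sub>F a in at_left (q \<delta> g). 1 - (\<delta> - \<eta>) < H\<^sub>U a"
      using isCont_H\<^sub>U[of "q \<delta> g"] by (intro order_tendstoD) (auto simp: isCont_def filterlim_at_split)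
    moreover have "\<forall>\<^sub>F a in at_left (q \<delta> g). a < q \<delta> g" by (simp add: eventually_at_filter)
    ultimately have "\<forall>\<^sub>F a in at_left (q \<delta> g). 1 - (\<delta> - \<eta>) < H\<^sub>U a \<and> a < q \<delta> g"
      by (rule eventually_conj)
    then obtain a where a: "1 - (\<delta> - \<eta>) < H\<^sub>U a" "a < q \<delta> g"
      using eventually_happens'[OF trivial_limit_at_left_real] by blast
    obtain G where G: "\<And>g'. g' \<ge> G \<Longrightarrow> q (\<delta> - \<eta>) g' < a"
      using eventually_q_less(1)[OF d'(1,3) a(1)] by (auto simp: eventually_at_top_linorder)
    \<comment> \<open>Adding \<open>w\<close> to \<open>G\<close> keeps the whole window to the
      right of \<open>G\<close>.\<close>
    have "loh w (\<delta> - \<eta>) g' < q \<delta> g" if "g' \<ge> G + w" for g'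
    proof -
      have "loh w (\<delta> - \<eta>) g' \<le> a"
        unfolding loh_def using that w G by (intro cSUP_least) (auto intro: less_imp_le)
      then show ?thesis using a(2) by simp
    qed
    moreover have "(\<lambda>g'. min (q \<delta> g) (loh w (\<delta> - \<eta>) g')) \<in> borel_measurable borel"
      by (intro borel_measurable_min borel_measurable_const measurable_loh d' w)
    ultimately show "\<delta> < measure (N01 \<Otimes>\<^sub>M N01)
        {p. min (SUP g'. q \<delta> g') (loh w (\<delta> - \<eta>) (g + fst p)) < T g (fst p) (snd p)}"
      unfolding sup
      by (intro rejection_prob_gt[OF d, where k = "\<lambda>g'. min (q \<delta> g) (loh w (\<delta> - \<eta>) g')" and G = "G + w"])
         (auto simp: min_less_iff_disj)
  qed
qed

end

section \<open>Independence from the joint characteristic function\<close>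

text \<open>Euler's formulas write the cosine and sine weights through the joint characteristic
  function at \<open>w\<close> and \<open>- w\<close>.\<close>

lemma (in prob_space) integral_cos_sin_iexp:
  fixes V W :: "'a \<Rightarrow> real"
  assumes [measurable]: "V \<in> borel_measurable M" "W \<in> borel_measurable M"
    and jc: "\<And>u w. (CLINT x|M. iexp (u * V x + w * W x)) = of_real (f u * g w)"
  shows "(CLINT x|M. (cos (w * W x)) *\<^sub>R iexp (u * V x)) = of_real (f u * (g w + g (- w)) / 2)"
    and "(CLINT x|M. (sin (w * W x)) *\<^sub>R iexp (u * V x)) = - \<i> * of_real (f u * (g w - g (- w)) / 2)"
proof -
  have int: "integrable M (\<lambda>x. iexp (u * V x + w * W x))" for u w
    by (intro integrable_iexp) auto
  have c: "(cos (w * W x)) *\<^sub>R iexp (u * V x)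
      = (1/2) * (iexp (u * V x + w * W x) + iexp (u * V x + (- w) * W x))" for x
    by (simp add: complex_eq_iff Re_exp Im_exp cos_add sin_add cos_diff sin_diff field_simps)
  have s: "(sin (w * W x)) *\<^sub>R iexp (u * V x)
      = (- \<i> / 2) * (iexp (u * V x + w * W x) - iexp (u * V x + (- w) * W x))" for x
    by (simp add: complex_eq_iff Re_exp Im_exp cos_add sin_add cos_diff sin_diff field_simps)
  show "(CLINT x|M. (cos (w * W x)) *\<^sub>R iexp (u * V x)) = of_real (f u * (g w + g (- w)) / 2)"
    unfolding c using int[of u w] int[of u "-w"] jc[of u w] jc[of u "-w"]
    by (simp add: field_simps)
  show "(CLINT x|M. (sin (w * W x)) *\<^sub>R iexp (u * V x)) = - \<i> * of_real (f u * (g w - g (- w)) / 2)"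
    unfolding s using int[of u w] int[of u "-w"] jc[of u w] jc[of u "-w"]
    by (simp add: field_simps)
qed

text \<open>Under the density h / k the variable \<open>V\<close> keeps its characteristic function,
  hence its law; evaluating both laws at \<open>A\<close> gives the claim.\<close>

lemma (in prob_space) weighted_char_eq_imp_integral_eq:
  fixes V h :: "'a \<Rightarrow> real"
  assumes [measurable]: "V \<in> borel_measurable M" "h \<in> borel_measurable M" "A \<in> sets borel"
    and h: "\<And>x. 0 \<le> h x" "\<And>x. h x \<le> C" and k: "k > 0"
    and eq: "\<And>u. (CLINT x|M. h x *\<^sub>R iexp (u * V x)) = of_real k * (CLINT x|M. iexp (u * V x))"
  shows "(\<integral>x. h x * indicator A (V x) \<partial>M) = k * prob (V -` A \<inter> space M)"
proof -
  define D where "D = density M (\<lambda>x. h x / k)"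
  have inth: "integrable M h"
    by (rule integrable_const_bound[of _ C]) (use h in \<open>auto intro: order_trans\<close>)
  \<comment> \<open>The hypothesis at u = 0 identifies \<open>k\<close> as the total mass of
    \<open>h\<close>, so h / k is a probability density.\<close>
  have "(CLINT x|M. h x *\<^sub>R (1::complex)) = of_real k"
    using eq[of 0] by (simp add: prob_space)
  then have "of_real (\<integral>x. h x \<partial>M) = (of_real k :: complex)"
    by (simp add: scaleR_conv_of_real)
  then have hk: "(\<integral>x. h x \<partial>M) = k" by (simp only: of_real_eq_iff)
  have "emeasure D (space M) = 1"
    unfolding D_def using h k inth hk
    by (subst emeasure_density) (auto simp: nn_integral_eq_integral intro!: mult_indicator_cong
        cong: nn_integral_cong)
  then interpret D: prob_space D
    by (intro prob_spaceI) (simp add: D_def)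
  have [measurable]: "V \<in> borel_measurable D" by (simp add: D_def)
  have "char (distr D borel V) u = char (distr M borel V) u" for u
  proof -
    have "char (distr D borel V) u = (CLINT x|M. (h x / k) *\<^sub>R iexp (u * V x))"
      unfolding char_def by (subst integral_distr; simp add: D_def; subst integral_density) (use h k in auto)
    also have "\<dots> = of_real (1/k) * (CLINT x|M. h x *\<^sub>R iexp (u * V x))"
      by (subst integral_mult_right_zero[symmetric]) (simp add: scaleR_conv_of_real field_simps)
    also have "\<dots> = char (distr M borel V) u"
      unfolding eq char_def using k by (simp add: integral_distr)
    finally show ?thesis .
  qed
  then have "distr D borel V = distr M borel V"
    by (intro Levy_uniqueness ext D.real_distribution_distr real_distribution_distr) auto
  then have "measure (distr D borel V) A = measure (distr M borel V) A" by simp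
  then have *: "measure D (V -` A \<inter> space M) = prob (V -` A \<inter> space M)"
    by (simp add: measure_distr D_def)
  have "measure D (V -` A \<inter> space M) = (\<integral>x. indicator (V -` A \<inter> space M) x \<partial>D)"
    by (simp add: D_def)
  also have "\<dots> = (\<integral>x. (h x / k) *\<^sub>R indicator (V -` A \<inter> space M) x \<partial>M)"
    unfolding D_def by (subst integral_density) (use h k in auto)
  also have "\<dots> = (\<integral>x. h x * indicator A (V x) / k \<partial>M)"
    by (intro Bochner_Integration.integral_cong) (auto simp: indicator_def)
  finally show ?thesis using * k by (simp add: field_simps)
qed

text \<open>One-dimensional Levy uniqueness is applied twice: first to the law of \<open>V\<close> reweighted by
  \<open>1 + cos (w W)\<close> and by \<open>1 + sin (w W)\<close>, then to the law of \<open>W\<close> reweighted by the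
  indicator of \<open>V \<in> A\<close>.\<close>

lemma (in prob_space) indep_var_if_joint_char:
  fixes V W :: "'a \<Rightarrow> real" and f g :: "real \<Rightarrow> real"
  assumes V [measurable]: "V \<in> borel_measurable M" and W [measurable]: "W \<in> borel_measurable M"
    and jc: "\<And>u w. (CLINT x|M. iexp (u * V x + w * W x)) = of_real (f u * g w)"
    and g: "\<And>w. g (- w) = g w" "\<And>w. g w > 0" and f0: "f 0 = 1" and g0: "g 0 = 1"
  shows "indep_var borel V borel W"
proof -
  have cV: "(CLINT x|M. iexp (u * V x)) = of_real (f u)" for u
    using jc[of u 0] by (simp add: g0)
  have cW: "(CLINT x|M. iexp (w * W x)) = of_real (g w)" for w
    using jc[of 0 w] by (simp add: f0)
  have int: "integrable M (\<lambda>x. iexp (u * V x))" for u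
    by (intro integrable_iexp) auto
  have int': "integrable M (\<lambda>x. r x *\<^sub>R iexp (u * V x))"
    if "r \<in> borel_measurable M" "\<And>x. \<bar>r x\<bar> \<le> 1" for u and r :: "'a \<Rightarrow> real"
    using that by (intro integrable_const_bound[of _ 1]) auto
  have AB: "prob (V -` A \<inter> W -` B \<inter> space M) = prob (V -` A \<inter> space M) * prob (W -` B \<inter> space M)"
    if [measurable]: "A \<in> sets borel" "B \<in> sets borel" for A B
  \<comment> \<open>The null case is separate because the probability of V in A later serves as the
    normalising constant, which must be positive.\<close>
  proof (cases "prob (V -` A \<inter> space M) = 0")
    case True
    have "prob (V -` A \<inter> W -` B \<inter> space M) \<le> prob (V -` A \<inter> space M)"
      by (rule finite_measure_mono) auto
    then show ?thesis using True by (simp add: measure_le_0_iff)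
  next
    case False
    let ?p = "prob (V -` A \<inter> space M)"
    have p: "?p > 0" using False by (simp add: zero_less_measure_iff)
    have ind: "(\<integral>x. (indicator A (V x) :: real) \<partial>M) = ?p"
    proof -
      have "(\<integral>x. (indicator A (V x) :: real) \<partial>M) = (\<integral>x. indicator (V -` A \<inter> space M) x \<partial>M)"
        by (intro Bochner_Integration.integral_cong) (auto simp: indicator_def)
      then show ?thesis by simp
    qed
    have cosA: "(\<integral>x. cos (w * W x) * indicator A (V x) \<partial>M) = g w * ?p" for w
    proof -
      \<comment> \<open>Adding 1 makes the weight nonnegative; its mass 1 + g w is positive. The
        contribution of the 1 is removed again below.\<close>
      have "(\<integral>x. (1 + cos (w * W x)) * indicator A (V x) \<partial>M) = (1 + g w) * ?p"
      proof (rule weighted_char_eq_imp_integral_eq[where C = 2])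
        fix u
        have "(CLINT x|M. iexp (u * V x) + (cos (w * W x)) *\<^sub>R iexp (u * V x)) = of_real (f u) + of_real (f u * g w)"
          using integral_cos_sin_iexp(1)[OF V W jc, of w u] cV[of u] int[of u] int'[of "\<lambda>x. cos (w * W x)" u]
          by (subst Bochner_Integration.integral_add) (auto simp: g)
        then show "(CLINT x|M. (1 + cos (w * W x)) *\<^sub>R iexp (u * V x)) = of_real (1 + g w) * (CLINT x|M. iexp (u * V x))"
          unfolding cV by (simp add: scaleR_add_left algebra_simps)
      qed (use g(2)[of w] cos_ge_minus_one cos_le_one in \<open>auto simp: add_pos_pos, smt+\<close>)
      moreover have "(\<integral>x. (1 + cos (w * W x)) * indicator A (V x) \<partial>M) =
          (\<integral>x. indicator A (V x) + cos (w * W x) * indicator A (V x) \<partial>M)"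
        by (simp add: algebra_simps)
      also have "\<dots> = (\<integral>x. indicator A (V x) \<partial>M) + (\<integral>x. cos (w * W x) * indicator A (V x) \<partial>M)"
        by (intro Bochner_Integration.integral_add integrable_const_bound[of _ 1])
           (auto simp: indicator_def)
      ultimately show ?thesis by (simp add: ind algebra_simps)
    qed
    have sinA: "(\<integral>x. sin (w * W x) * indicator A (V x) \<partial>M) = 0" for w
    proof -
      \<comment> \<open>Evenness of \<open>g\<close> kills the sine part of the characteristic
        function, so the mass is 1.\<close>
      have "(\<integral>x. (1 + sin (w * W x)) * indicator A (V x) \<partial>M) = 1 * ?p"
      proof (rule weighted_char_eq_imp_integral_eq[where C = 2])
        fix u
        have "(CLINT x|M. iexp (u * V x) + (sin (w * W x)) *\<^sub>R iexp (u * V x)) = of_real (f u)"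
          using integral_cos_sin_iexp(2)[OF V W jc, of w u] cV[of u] int[of u] int'[of "\<lambda>x. sin (w * W x)" u]
          by (subst Bochner_Integration.integral_add) (auto simp: g)
        then show "(CLINT x|M. (1 + sin (w * W x)) *\<^sub>R iexp (u * V x)) = of_real 1 * (CLINT x|M. iexp (u * V x))"
          unfolding cV by (simp add: scaleR_add_left algebra_simps)
      qed (use sin_ge_minus_one sin_le_one in \<open>auto, smt+\<close>)
      moreover have "(\<integral>x. (1 + sin (w * W x)) * indicator A (V x) \<partial>M) =
          (\<integral>x. indicator A (V x) + sin (w * W x) * indicator A (V x) \<partial>M)"
        by (simp add: algebra_simps)
      also have "\<dots> = (\<integral>x. indicator A (V x) \<partial>M) + (\<integral>x. sin (w * W x) * indicator A (V x) \<partial>M)"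
        by (intro Bochner_Integration.integral_add integrable_const_bound[of _ 1])
           (auto simp: indicator_def)
      ultimately show ?thesis by (simp add: ind)
    qed
    \<comment> \<open>Cosine and sine parts are reassembled: restricting to V in A only scales the
      characteristic function of \<open>W\<close>, so the reweighting lemma applies to
      \<open>W\<close>.\<close>
    have "(CLINT x|M. (indicator A (V x) :: real) *\<^sub>R iexp (w * W x)) = of_real ?p * (CLINT x|M. iexp (w * W x))" for w
    proof -
      have "(CLINT x|M. (indicator A (V x) :: real) *\<^sub>R iexp (w * W x)) =
         (CLINT x|M. of_real (cos (w * W x) * indicator A (V x)) + \<i> * of_real (sin (w * W x) * indicator A (V x)))"
        by (intro Bochner_Integration.integral_cong)
          (auto simp: complex_eq_iff Re_exp Im_exp indicator_def)
      also have "\<dots> = (CLINT x|M. of_real (cos (w * W x) * indicator A (V x)))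
            + \<i> * (CLINT x|M. of_real (sin (w * W x) * indicator A (V x)))"
        by (subst Bochner_Integration.integral_add)
           (auto simp: indicator_def norm_mult simp del: of_real_mult intro!: integrable_const_bound[of _ 1])
      also have "\<dots> = of_real (g w * ?p)"
        unfolding integral_complex_of_real cosA sinA by simp
      finally show ?thesis unfolding cW by simp
    qed
    then have "(\<integral>x. indicator A (V x) * indicator B (W x) \<partial>M) = ?p * prob (W -` B \<inter> space M)"
      by (intro weighted_char_eq_imp_integral_eq[where C = 1]) (auto simp: p indicator_def)
    moreover have "(\<integral>x. (indicator A (V x) * indicator B (W x) :: real) \<partial>M) =
        (\<integral>x. indicator (V -` A \<inter> W -` B \<inter> space M) x \<partial>M)"
      by (intro Bochner_Integration.integral_cong) (auto simp: indicator_def)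
    ultimately show ?thesis by simp
  qed
  show ?thesis
    unfolding indep_var_distribution_eq
  proof (intro conjI V W pair_measure_eqI)
    interpret DV: prob_space "distr M borel V" by (rule prob_space_distr) simp
    interpret DW: prob_space "distr M borel W" by (rule prob_space_distr) simp
    show "sigma_finite_measure (distr M borel V)" "sigma_finite_measure (distr M borel W)" ..
    fix A B assume "A \<in> sets (distr M borel V)" "B \<in> sets (distr M borel W)"
    then have [measurable]: "A \<in> sets borel" "B \<in> sets borel" by auto
    have "(\<lambda>x. (V x, W x)) -` (A \<times> B) \<inter> space M = V -` A \<inter> W -` B \<inter> space M" by auto
    then show "emeasure (distr M borel V) A * emeasure (distr M borel W) B =
        emeasure (distr M (borel \<Otimes>\<^sub>M borel) (\<lambda>x. (V x, W x))) (A \<times> B)"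
      using AB[of A B] by (simp add: emeasure_distr emeasure_eq_measure ennreal_mult)
  qed simp
qed

text \<open>Independence of the errors turns the joint characteristic function into the exponential
  of a quadratic form in (u, w), which orthonormality makes diagonal. Hence it factorises.\<close>

lemma (in prob_space) distr_orthonormal_combinations_std_normal:
  fixes \<epsilon> :: "'i \<Rightarrow> 'a \<Rightarrow> real" and a d :: "'i \<Rightarrow> real"
  assumes I: "finite I" and ind: "indep_vars (\<lambda>_. borel) \<epsilon> I"
    and nrm: "\<And>i. i \<in> I \<Longrightarrow> distributed M lborel (\<epsilon> i) std_normal_density"
    and orth: "(\<Sum>i\<in>I. (a i)\<^sup>2) = 1" "(\<Sum>i\<in>I. (d i)\<^sup>2) = 1" "(\<Sum>i\<in>I. a i * d i) = 0"
  shows "distr M (borel \<Otimes>\<^sub>M borel) (\<lambda>x. (\<Sum>i\<in>I. a i * \<epsilon> i x, \<Sum>i\<in>I. d i * \<epsilon> i x))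
    = std_normal_distribution \<Otimes>\<^sub>M std_normal_distribution"
proof -
  have e [measurable]: "\<epsilon> i \<in> borel_measurable M" if "i \<in> I" for i
    using distributed_measurable[OF nrm[OF that]] by simp
  define V where "V x = (\<Sum>i\<in>I. a i * \<epsilon> i x)" for x
  define W where "W x = (\<Sum>i\<in>I. d i * \<epsilon> i x)" for x
  have V [measurable]: "V \<in> borel_measurable M" and W [measurable]: "W \<in> borel_measurable M"
    unfolding V_def W_def by measurable
  have jc: "(CLINT x|M. iexp (u * V x + w * W x)) = of_real (exp (- u\<^sup>2 / 2) * exp (- w\<^sup>2 / 2))" for u w
  proof -
    let ?b = "\<lambda>i. u * a i + w * d i"
    have "(CLINT x|M. iexp (u * V x + w * W x)) = char (distr M borel (\<lambda>x. \<Sum>i\<in>I. ?b i * \<epsilon> i x)) 1"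
      unfolding char_def by (subst integral_distr)
        (auto simp: V_def W_def sum_distrib_left algebra_simps sum.distrib)
    also have "\<dots> = (\<Prod>i\<in>I. char (distr M borel (\<lambda>x. ?b i * \<epsilon> i x)) 1)"
      by (intro char_distr_sum indep_vars_compose2[OF ind]) auto
    also have "\<dots> = (\<Prod>i\<in>I. of_real (exp (- (?b i)\<^sup>2 / 2)))"
    proof (intro prod.cong refl)
      fix i assume i: "i \<in> I"
      then have [measurable]: "\<epsilon> i \<in> borel_measurable M" by simp
      have "char (distr M borel (\<lambda>x. ?b i * \<epsilon> i x)) 1 = char (distr M borel (\<epsilon> i)) (?b i)"
        unfolding char_def by (simp add: integral_distr)
      also have "distr M borel (\<epsilon> i) = std_normal_distribution"
        using distributed_distr_eq_density[OF nrm[OF i]] by (simp cong: distr_cong)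
      finally show "char (distr M borel (\<lambda>x. ?b i * \<epsilon> i x)) 1 = of_real (exp (- (?b i)\<^sup>2 / 2))"
        by (simp add: char_std_normal_distribution)
    qed
    also have "\<dots> = of_real (exp (\<Sum>i\<in>I. - (?b i)\<^sup>2 / 2))"
      by (simp add: exp_sum[OF I])
    \<comment> \<open>The mixed sum is isolated here so that orthogonality can remove it.\<close>
    also have "(\<Sum>i\<in>I. - (?b i)\<^sup>2 / 2) = (- u\<^sup>2 / 2) * (\<Sum>i\<in>I. (a i)\<^sup>2) + (- w\<^sup>2 / 2) * (\<Sum>i\<in>I. (d i)\<^sup>2)
        - u * w * (\<Sum>i\<in>I. a i * d i)"
      by (simp add: sum_distrib_left sum.distrib[symmetric] sum_subtractf[symmetric] field_simps power2_eq_square)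
    finally show ?thesis by (simp add: orth mult_exp_exp flip: of_real_mult)
  qed
  have "indep_var borel V borel W"
    by (rule indep_var_if_joint_char[OF V W jc]) auto
  then have "distr M (borel \<Otimes>\<^sub>M borel) (\<lambda>x. (V x, W x)) = distr M borel V \<Otimes>\<^sub>M distr M borel W"
    by (simp add: indep_var_distribution_eq)
  also have "distr M borel V = std_normal_distribution"
    using jc[of _ 0] by (intro Levy_uniqueness real_dist_normal_dist real_distribution_distr ext)
      (auto simp: char_std_normal_distribution char_def integral_distr)
  also have "distr M borel W = std_normal_distribution"
    using jc[of 0] by (intro Levy_uniqueness real_dist_normal_dist real_distribution_distr ext)
      (auto simp: char_std_normal_distribution char_def integral_distr)
  finally show ?thesis by (simp add: V_def[abs_def] W_def[abs_def])
qed

section \<open>Least squares with two regressors\<close>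

definition gram :: "nat \<Rightarrow> (nat \<Rightarrow> real^2) \<Rightarrow> 2 \<Rightarrow> 2 \<Rightarrow> real" where
  "gram n x i j = scaled_gram n x $ i $ j"

text \<open>The right-hand side X'y / n of the normal equations.\<close>

definition cross :: "nat \<Rightarrow> (nat \<Rightarrow> real^2) \<Rightarrow> (nat \<Rightarrow> real) \<Rightarrow> 2 \<Rightarrow> real" where
  "cross n x y i = (\<Sum>t=1..n. x t $ i * y t) / real n"

definition gram_det :: "nat \<Rightarrow> (nat \<Rightarrow> real^2) \<Rightarrow> real" where
  "gram_det n x = gram n x 1 1 * gram n x 2 2 - (gram n x 1 2)\<^sup>2"

lemma gram_sum: "gram n x i j = (\<Sum>t=1..n. x t $ i * x t $ j) / real n"
  by (simp add: gram_def scaled_gram_def)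

lemma gram_21: "gram n x 2 1 = gram n x 1 2"
  by (simp add: gram_sum mult.commute)

text \<open>Used both for the positive definiteness of the Gram matrix and for the quadratic part of
  the residual sum of squares.\<close>

lemma gram_quadratic_form:
  "gram n x 1 1 * a\<^sup>2 + 2 * gram n x 1 2 * a * b + gram n x 2 2 * b\<^sup>2
    = (\<Sum>t=1..n. (a * x t $ 1 + b * x t $ 2)\<^sup>2) / real n"
proof -
  have "gram n x 1 1 * a\<^sup>2 + 2 * gram n x 1 2 * a * b + gram n x 2 2 * b\<^sup>2
    = ((\<Sum>t=1..n. x t $ 1 * x t $ 1) * a\<^sup>2 + 2 * (\<Sum>t=1..n. x t $ 1 * x t $ 2) * a * b
       + (\<Sum>t=1..n. x t $ 2 * x t $ 2) * b\<^sup>2) / real n"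
    by (simp add: gram_sum add_divide_distrib)
  also have "\<dots> = (\<Sum>t=1..n. (x t $ 1 * x t $ 1) * a\<^sup>2 + 2 * (x t $ 1 * x t $ 2) * a * b + (x t $ 2 * x t $ 2) * b\<^sup>2) / real n"
    by (simp add: sum_distrib_left sum_distrib_right sum.distrib)
  also have "\<dots> = (\<Sum>t=1..n. (a * x t $ 1 + b * x t $ 2)\<^sup>2) / real n"
    by (intro arg_cong[where f = "\<lambda>s. s / real n"] sum.cong refl) (simp add: power2_eq_square algebra_simps)
  finally show ?thesis .
qed

lemma inner_2: "(a :: real^2) \<bullet> b = a $ 1 * b $ 1 + a $ 2 * b $ 2"
  by (simp add: inner_vec_def sum_2)

lemma vec2_eq_iff: "(a :: real^2) = b \<longleftrightarrow> a $ 1 = b $ 1 \<and> a $ 2 = b $ 2"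
  by (simp add: vec_eq_iff forall_2)

lemma rss_expand:
  assumes "n > 0"
  shows "rss n x y \<theta> = (\<Sum>t=1..n. (y t)\<^sup>2) - 2 * real n * (\<theta> $ 1 * cross n x y 1 + \<theta> $ 2 * cross n x y 2)
    + real n * (gram n x 1 1 * (\<theta> $ 1)\<^sup>2 + 2 * gram n x 1 2 * \<theta> $ 1 * \<theta> $ 2 + gram n x 2 2 * (\<theta> $ 2)\<^sup>2)"
proof -
  have "rss n x y \<theta> = (\<Sum>t=1..n. (y t)\<^sup>2 - 2 * \<theta> $ 1 * (x t $ 1 * y t) - 2 * \<theta> $ 2 * (x t $ 2 * y t)
     + (\<theta> $ 1 * x t $ 1 + \<theta> $ 2 * x t $ 2)\<^sup>2)"
    unfolding rss_def by (intro sum.cong refl) (simp add: power2_eq_square algebra_simps)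
  also have "\<dots> = (\<Sum>t=1..n. (y t)\<^sup>2) - 2 * \<theta> $ 1 * (\<Sum>t=1..n. x t $ 1 * y t) - 2 * \<theta> $ 2 * (\<Sum>t=1..n. x t $ 2 * y t)
     + (\<Sum>t=1..n. (\<theta> $ 1 * x t $ 1 + \<theta> $ 2 * x t $ 2)\<^sup>2)"
    by (simp add: sum.distrib sum_subtractf sum_distrib_left)
  also have "\<dots> = (\<Sum>t=1..n. (y t)\<^sup>2) - 2 * real n * (\<theta> $ 1 * cross n x y 1 + \<theta> $ 2 * cross n x y 2)
     + real n * ((\<Sum>t=1..n. (\<theta> $ 1 * x t $ 1 + \<theta> $ 2 * x t $ 2)\<^sup>2) / real n)"
    using assms by (simp add: cross_def distrib_left)
  finally show ?thesis by (simp only: gram_quadratic_form)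
qed

text \<open>\<open>arg_min\<close> is a choice among minimisers; a strict minimiser leaves it no
  freedom.\<close>

lemma arg_min_unique:
  fixes f :: "'b \<Rightarrow> real"
  assumes "P k" "\<And>x. P x \<Longrightarrow> x \<noteq> k \<Longrightarrow> f k < f x"
  shows "arg_min f P = k"
  by (rule arg_minI[of P k f "\<lambda>x. x = k"]) (use assms in \<open>metis order.asym\<close>)+

locale full_rank_design =
  fixes n :: nat and x :: "nat \<Rightarrow> real^2"
  assumes n_pos: "n > 0" and rank: "design_rank n x = 2"
begin

text \<open>If the form failed to be positive, every regressor row would be orthogonal to the
  nonzero vector (a, b), and the row space would have dimension at most 1.\<close>

lemma quadratic_form_pos:
  assumes "a \<noteq> 0 \<or> b \<noteq> 0"
  shows "gram n x 1 1 * a\<^sup>2 + 2 * gram n x 1 2 * a * b + gram n x 2 2 * b\<^sup>2 > 0"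
proof (rule ccontr)
  assume "\<not> ?thesis"
  then have "(\<Sum>t=1..n. (a * x t $ 1 + b * x t $ 2)\<^sup>2) \<le> 0"
    unfolding gram_quadratic_form using n_pos by (simp add: zero_less_divide_iff not_less)
  then have "(\<Sum>t=1..n. (a * x t $ 1 + b * x t $ 2)\<^sup>2) = 0"
    by (intro antisym sum_nonneg) auto
  then have z: "a * x t $ 1 + b * x t $ 2 = 0" if "t \<in> {1..n}" for t
    using that by (subst (asm) sum_nonneg_eq_0_iff) auto
  define v :: "real^2" where "v = vector [a, b]"
  have "v \<noteq> 0" using assms by (auto simp: v_def vec2_eq_iff)
  have "x ` {1..n} \<subseteq> {w. v \<bullet> w = 0}"
    using z by (auto simp: v_def inner_2)
  then have "dim (x ` {1..n}) \<le> dim {w. v \<bullet> w = 0}" by (rule dim_subset)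
  also have "\<dots> = 1" using dim_hyperplane[OF \<open>v \<noteq> 0\<close>] by simp
  finally show False using rank by (simp add: design_rank_def)
qed

lemma gram_11_pos: "gram n x 1 1 > 0"
  using quadratic_form_pos[of 1 0] by simp

lemma gram_22_pos: "gram n x 2 2 > 0"
  using quadratic_form_pos[of 0 1] by simp

lemma gram_det_pos: "gram_det n x > 0"
proof -
  \<comment> \<open>The quadratic form at this vector equals the left-hand side.\<close>
  have "gram n x 1 1 * gram_det n x > 0"
    using quadratic_form_pos[of "- gram n x 1 2" "gram n x 1 1"] gram_11_pos
    by (simp add: gram_det_def power2_eq_square algebra_simps)
  then show ?thesis using gram_11_pos by (simp add: zero_less_mult_iff)
qed

lemma matrix_inv_scaled_gram:
  "matrix_inv (scaled_gram n x) = vector [vector [gram n x 2 2 / gram_det n x, - gram n x 1 2 / gram_det n x],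
     vector [- gram n x 1 2 / gram_det n x, gram n x 1 1 / gram_det n x]]" (is "_ = ?B")
proof -
  let ?A = "scaled_gram n x"
  have D: "gram_det n x \<noteq> 0" using gram_det_pos by simp
  have "?A ** ?B = mat 1" "?B ** ?A = mat 1"
    using D unfolding vec_eq_iff forall_2 matrix_matrix_mult_def sum_2 mat_def
    by (simp_all add: gram_def[symmetric] gram_21, simp_all add: field_simps)
       (simp_all add: gram_det_def power2_eq_square algebra_simps)
  then have "\<exists>A'. ?A ** A' = mat 1 \<and> A' ** ?A = mat 1" by blast
  then have inv: "?A ** matrix_inv ?A = mat 1"
    unfolding matrix_inv_def by (rule someI_ex[THEN conjunct1])
  \<comment> \<open>\<open>matrix_inv\<close> is again a choice; associativity shows that it must be
    the explicit two-sided inverse.\<close>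
  have "matrix_inv ?A = (?B ** ?A) ** matrix_inv ?A"
    unfolding \<open>?B ** ?A = mat 1\<close> by (rule matrix_mul_lid[symmetric])
  also have "\<dots> = ?B"
    unfolding matrix_mul_assoc[symmetric] inv by (rule matrix_mul_rid)
  finally show ?thesis .
qed

lemma sigma_alpha_eq: "sigma_alpha n x = sqrt (gram n x 2 2 / gram_det n x)"
  by (simp add: sigma_alpha_def matrix_inv_scaled_gram)

lemma sigma_beta_eq: "sigma_beta n x = sqrt (gram n x 1 1 / gram_det n x)"
  by (simp add: sigma_beta_def matrix_inv_scaled_gram)

lemma rho_eq: "rho n x = - gram n x 1 2 / sqrt (gram n x 1 1 * gram n x 2 2)"
  using gram_det_pos
  by (simp add: rho_def sigma_alpha_eq sigma_beta_eq matrix_inv_scaled_gram real_sqrt_divide real_sqrt_mult)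

lemma one_minus_rho_square: "1 - (rho n x)\<^sup>2 = gram_det n x / (gram n x 1 1 * gram n x 2 2)"
  using gram_11_pos gram_22_pos
  by (simp add: rho_eq power_divide real_sqrt_mult power_mult_distrib gram_det_def field_simps)

lemma abs_rho_less_1: "\<bar>rho n x\<bar> < 1"
proof -
  have "1 - (rho n x)\<^sup>2 > 0"
    unfolding one_minus_rho_square using gram_11_pos gram_22_pos gram_det_pos by simp
  then show ?thesis by (simp add: abs_square_less_1)
qed

text \<open>The displayed vector solves the normal equations \<open>b1\<close> and
  \<open>b2\<close>, so the excess of the residual sum of squares elsewhere is the positive Gram
  form of the difference.\<close>

lemma ls_U_eq:
  "ls_U n x y = vector [(gram n x 2 2 * cross n x y 1 - gram n x 1 2 * cross n x y 2) / gram_det n x,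
     (gram n x 1 1 * cross n x y 2 - gram n x 1 2 * cross n x y 1) / gram_det n x]"
    (is "_ = vector [?a, ?b]")
  unfolding ls_U_def
proof (rule arg_min_unique)
  fix \<theta> :: "real^2" assume "\<theta> \<noteq> vector [?a, ?b]"
  then have ne: "\<theta> $ 1 - ?a \<noteq> 0 \<or> \<theta> $ 2 - ?b \<noteq> 0" by (simp add: vec2_eq_iff)
  have D: "gram_det n x \<noteq> 0" using gram_det_pos by simp
  have b1: "cross n x y 1 = gram n x 1 1 * ?a + gram n x 1 2 * ?b"
    and b2: "cross n x y 2 = gram n x 1 2 * ?a + gram n x 2 2 * ?b"
    using D by (simp_all add: field_simps) (simp_all add: gram_det_def power2_eq_square algebra_simps)
  \<comment> \<open>General \<open>a\<close> and \<open>b\<close> keep the fractions out of the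
    algebra.\<close>
  have "rss n x y \<theta> - rss n x y (vector [a, b])
      = real n * (gram n x 1 1 * (\<theta> $ 1 - a)\<^sup>2 + 2 * gram n x 1 2 * (\<theta> $ 1 - a) * (\<theta> $ 2 - b) + gram n x 2 2 * (\<theta> $ 2 - b)\<^sup>2)"
    if "cross n x y 1 = gram n x 1 1 * a + gram n x 1 2 * b" "cross n x y 2 = gram n x 1 2 * a + gram n x 2 2 * b" for a b
    unfolding rss_expand[OF n_pos] that by (simp add: power2_eq_square algebra_simps)
  from this[OF b1 b2] show "rss n x y (vector [?a, ?b]) < rss n x y \<theta>"
    using mult_pos_pos[OF _ quadratic_form_pos[OF ne], of "real n"] n_pos by linarith
qed simp

lemma ls_R_eq: "ls_R n x y = vector [cross n x y 1 / gram n x 1 1, 0]" (is "_ = vector [?a, 0]")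
  unfolding ls_R_def
proof (rule arg_min_unique)
  fix \<theta> :: "real^2" assume "\<theta> $ 2 = 0" "\<theta> \<noteq> vector [?a, 0]"
  then have ne: "\<theta> $ 1 - ?a \<noteq> 0 \<or> (0::real) \<noteq> 0" by (simp add: vec2_eq_iff)
  have b1: "cross n x y 1 = gram n x 1 1 * ?a" using gram_11_pos by simp
  have "rss n x y \<theta> - rss n x y (vector [a, 0]) = real n * (gram n x 1 1 * (\<theta> $ 1 - a)\<^sup>2)"
    if "cross n x y 1 = gram n x 1 1 * a" for a
    unfolding rss_expand[OF n_pos] that using \<open>\<theta> $ 2 = 0\<close> by (simp add: power2_eq_square algebra_simps)
  from this[OF b1] show "rss n x y (vector [?a, 0]) < rss n x y \<theta>"
    using mult_pos_pos[OF _ quadratic_form_pos[OF ne], of "real n"] n_pos by simp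
qed simp

text \<open>The weights of the errors in the standardised \<open>beta_U\<close> and \<open>alpha_R\<close>, respectively; their orthogonality
  makes the restricted estimator independent of the pre-test.\<close>

definition wV :: "nat \<Rightarrow> real" where
  "wV t = (gram n x 1 1 * x t $ 2 - gram n x 1 2 * x t $ 1) / sqrt (real n * gram n x 1 1 * gram_det n x)"

definition wW :: "nat \<Rightarrow> real" where
  "wW t = x t $ 1 / sqrt (real n * gram n x 1 1)"

lemma sqrt_cancel: "real n * p / (sqrt (real n) * q) = sqrt (real n) * p / q"
  by (simp only: times_divide_times_eq[symmetric] real_div_sqrt[OF of_nat_0_le_iff] times_divide_eq_right)

lemma sum_wV: "(\<Sum>t=1..n. wV t * y t) =
    sqrt (real n) * (gram n x 1 1 * cross n x y 2 - gram n x 1 2 * cross n x y 1) / sqrt (gram n x 1 1 * gram_det n x)"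
proof -
  have "(\<Sum>t=1..n. wV t * y t) = (gram n x 1 1 * (\<Sum>t=1..n. x t $ 2 * y t) - gram n x 1 2 * (\<Sum>t=1..n. x t $ 1 * y t))
      / sqrt (real n * gram n x 1 1 * gram_det n x)"
    unfolding sum_distrib_left sum_subtractf[symmetric] sum_divide_distrib
    by (intro sum.cong refl) (simp add: wV_def algebra_simps)
  also have "\<dots> = real n * (gram n x 1 1 * cross n x y 2 - gram n x 1 2 * cross n x y 1)
      / (sqrt (real n) * sqrt (gram n x 1 1 * gram_det n x))"
    using n_pos by (simp add: cross_def real_sqrt_mult algebra_simps)
  finally show ?thesis by (simp only: sqrt_cancel)
qed

lemma sum_wW: "(\<Sum>t=1..n. wW t * y t) = sqrt (real n) * cross n x y 1 / sqrt (gram n x 1 1)"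
proof -
  have "(\<Sum>t=1..n. wW t * y t) = (\<Sum>t=1..n. x t $ 1 * y t) / sqrt (real n * gram n x 1 1)"
    by (simp add: wW_def sum_divide_distrib)
  also have "\<dots> = real n * cross n x y 1 / (sqrt (real n) * sqrt (gram n x 1 1))"
    using n_pos by (simp add: cross_def real_sqrt_mult)
  finally show ?thesis by (simp only: sqrt_cancel)
qed

lemma cross_x: "cross n x (\<lambda>t. x t $ j) i = gram n x i j"
  by (simp add: cross_def gram_sum)

lemma cross_lin: "cross n x (\<lambda>t. p * u t + q * v t) i = p * cross n x u i + q * cross n x v i"
  by (simp add: cross_def sum.distrib sum_distrib_left add_divide_distrib algebra_simps)

text \<open>\<open>wV\<close> is a multiple of the residual of the second regressor after projection
  on the first, hence orthogonal to the first.\<close>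

lemma cross_wV: "cross n x wV 1 = 0"
  "cross n x wV 2 = gram_det n x / sqrt (real n * gram n x 1 1 * gram_det n x)"
proof -
  let ?r = "sqrt (real n * gram n x 1 1 * gram_det n x)"
  have "wV = (\<lambda>t. (gram n x 1 1 / ?r) * x t $ 2 + (- gram n x 1 2 / ?r) * x t $ 1)"
    by (auto simp: fun_eq_iff wV_def diff_divide_distrib)
  then have "cross n x wV i = (gram n x 1 1 / ?r) * gram n x i 2 + (- gram n x 1 2 / ?r) * gram n x i 1" for i
    by (simp only: cross_lin cross_x)
  then show "cross n x wV 1 = 0" "cross n x wV 2 = gram_det n x / ?r"
    by (simp_all add: gram_21 gram_det_def diff_divide_distrib power2_eq_square)
qed

lemma cross_wW: "cross n x wW 1 = gram n x 1 1 / sqrt (real n * gram n x 1 1)"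
proof -
  have "wW = (\<lambda>t. (1 / sqrt (real n * gram n x 1 1)) * x t $ 1 + 0 * x t $ 1)"
    by (auto simp: fun_eq_iff wW_def)
  then show ?thesis by (simp only: cross_lin cross_x) simp
qed

text \<open>The formulas \<open>sum_wV\<close> and \<open>sum_wW\<close> are applied with the
  weights themselves as the data vector.\<close>

lemma orthonormal_weights:
  "(\<Sum>t=1..n. (wV t)\<^sup>2) = 1" "(\<Sum>t=1..n. (wW t)\<^sup>2) = 1" "(\<Sum>t=1..n. wV t * wW t) = 0"
proof -
  note pos = gram_11_pos gram_det_pos n_pos
  show "(\<Sum>t=1..n. (wV t)\<^sup>2) = 1"
    using sum_wV[of wV] pos by (simp add: cross_wV power2_eq_square real_sqrt_mult field_simps)
  show "(\<Sum>t=1..n. (wW t)\<^sup>2) = 1"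
    using sum_wW[of wW] pos by (simp add: cross_wW power2_eq_square real_sqrt_mult field_simps)
  show "(\<Sum>t=1..n. wV t * wW t) = 0"
    using sum_wW[of wV] by (simp add: cross_wV mult.commute)
qed

end

section \<open>The regression model\<close>

context full_rank_design
begin

definition std_beta :: "(nat \<Rightarrow> real) \<Rightarrow> real" where
  "std_beta y = sqrt (real n) * beta_U n x y / sigma_beta n x"

text \<open>The parameter \<open>g\<close> of the standardised problem.\<close>

definition local_param :: "real \<Rightarrow> real" where
  "local_param \<beta> = sqrt (real n) * \<beta> / sigma_beta n x"

lemma sigma_beta_pos: "sigma_beta n x > 0"
  using gram_11_pos gram_det_pos by (simp add: sigma_beta_eq)

text \<open>Naming the three square roots turns all standardised quantities into rational
  expressions, so the identities below become polynomial algebra.\<close>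

lemma gram_roots:
  obtains a b d where "a > 0" "b > 0" "d > 0"
    "gram n x 1 1 = a\<^sup>2" "gram n x 2 2 = b\<^sup>2" "gram_det n x = d\<^sup>2" "(gram n x 1 2)\<^sup>2 = a\<^sup>2 * b\<^sup>2 - d\<^sup>2"
    "sigma_alpha n x = b / d" "sigma_beta n x = a / d"
    "rho n x = - gram n x 1 2 / (a * b)" "sqrt (1 - (rho n x)\<^sup>2) = d / (a * b)"
proof (rule that[of "sqrt (gram n x 1 1)" "sqrt (gram n x 2 2)" "sqrt (gram_det n x)"])
  show "sqrt (1 - (rho n x)\<^sup>2) = sqrt (gram_det n x) / (sqrt (gram n x 1 1) * sqrt (gram n x 2 2))"
    by (simp add: one_minus_rho_square real_sqrt_divide real_sqrt_mult)
qed (use gram_11_pos gram_22_pos gram_det_pos in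
  \<open>simp_all add: rho_eq sigma_alpha_eq sigma_beta_eq real_sqrt_divide real_sqrt_mult gram_det_def\<close>)

lemma std_beta_eq: "std_beta y = (\<Sum>t=1..n. wV t * y t)"
proof -
  obtain a d where *: "a > 0" "d > 0" "gram n x 1 1 = a\<^sup>2" "gram_det n x = d\<^sup>2" "sigma_beta n x = a / d"
    using gram_roots by blast
  show ?thesis
    unfolding std_beta_def sum_wV beta_U_def ls_U_eq * using *(1,2)
    by (simp add: real_sqrt_mult power2_eq_square field_simps)
qed

lemma std_alpha_R:
  "sqrt (real n) * (alpha_R n x y - \<alpha>) / (sigma_alpha n x * sqrt (1 - (rho n x)\<^sup>2))
    = (\<Sum>t=1..n. wW t * y t) - sqrt (real n) * \<alpha> * sqrt (gram n x 1 1)"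
proof -
  obtain a b d where *: "a > 0" "b > 0" "d > 0" "gram n x 1 1 = a\<^sup>2" "sigma_alpha n x = b / d"
      "sqrt (1 - (rho n x)\<^sup>2) = d / (a * b)"
    using gram_roots by blast
  show ?thesis
    unfolding sum_wW alpha_R_def ls_R_eq * using *(1-3)
    by (simp add: power2_eq_square field_simps)
qed

text \<open>The unrestricted estimator decomposes into the restricted one and the pre-test
  statistic, with coefficients \<open>s\<close> and \<rho>; this is the source of the \<rho> * v + s
  * w branch.\<close>

lemma std_alpha_U:
  "sqrt (real n) * (alpha_U n x y - \<alpha>) / sigma_alpha n x
    = sqrt (1 - (rho n x)\<^sup>2) * ((\<Sum>t=1..n. wW t * y t) - sqrt (real n) * \<alpha> * sqrt (gram n x 1 1))
      + rho n x * std_beta y"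
proof -
  obtain a b d where pos: "a > 0" "b > 0" "d > 0" and eqs: "gram n x 1 1 = a\<^sup>2" "gram n x 2 2 = b\<^sup>2" "gram_det n x = d\<^sup>2"
      "sigma_alpha n x = b / d" "rho n x = - gram n x 1 2 / (a * b)"
    and g: "(gram n x 1 2)\<^sup>2 = a\<^sup>2 * b\<^sup>2 - d\<^sup>2" and s: "sqrt (1 - (rho n x)\<^sup>2) = d / (a * b)"
    using gram_roots by blast
  let ?g = "gram n x 1 2" and ?c1 = "cross n x y 1" and ?c2 = "cross n x y 2"
  \<comment> \<open>Eliminating the squared off-diagonal entry makes the factor
    \<open>a\<^sup>2\<close> appear, which then cancels.\<close>
  have "?g\<^sup>2 * ?c1 = (a\<^sup>2 * b\<^sup>2 - d\<^sup>2) * ?c1" by (simp only: g)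
  then have key: "d\<^sup>2 * ?c1 - \<alpha> * a\<^sup>2 * d\<^sup>2 - ?g * (a\<^sup>2 * ?c2 - ?g * ?c1) = a\<^sup>2 * (b\<^sup>2 * ?c1 - ?g * ?c2 - \<alpha> * d\<^sup>2)"
    by (simp add: algebra_simps power2_eq_square)
  have "sqrt (1 - (rho n x)\<^sup>2) * ((\<Sum>t=1..n. wW t * y t) - sqrt (real n) * \<alpha> * sqrt (gram n x 1 1)) + rho n x * std_beta y
      = sqrt (real n) * (d\<^sup>2 * ?c1 - \<alpha> * a\<^sup>2 * d\<^sup>2 - ?g * (a\<^sup>2 * ?c2 - ?g * ?c1)) / (a\<^sup>2 * b * d)"
    unfolding s unfolding std_beta_eq sum_wV sum_wW eqs using pos
    by (simp add: real_sqrt_mult field_simps) (simp add: power2_eq_square power4_eq_xxxx algebra_simps)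
  also have "\<dots> = sqrt (real n) * (alpha_U n x y - \<alpha>) / sigma_alpha n x"
    unfolding key alpha_U_def ls_U_eq eqs using pos
    by (simp add: power2_eq_square field_simps)
  finally show ?thesis by simp
qed

lemma T_stat_eq:
  "T_stat n x c \<alpha> y = (let R = (\<Sum>t=1..n. wW t * y t) - sqrt (real n) * \<alpha> * sqrt (gram n x 1 1)
     in if \<bar>std_beta y\<bar> \<le> c then R else sqrt (1 - (rho n x)\<^sup>2) * R + rho n x * std_beta y)"
  by (simp add: T_stat_def selects_U_def Let_def std_alpha_R std_alpha_U std_beta_def[symmetric])

lemma sum_wV_mean:
  "(\<Sum>t=1..n. wV t * (\<alpha> * x t $ 1 + \<beta> * x t $ 2)) = local_param \<beta>"
proof -
  have "(\<Sum>t=1..n. wV t * (\<alpha> * x t $ 1 + \<beta> * x t $ 2)) = sqrt (real n) * (\<beta> * gram_det n x) / sqrt (gram n x 1 1 * gram_det n x)"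
    unfolding sum_wV cross_lin cross_x by (simp add: gram_21 gram_det_def power2_eq_square algebra_simps)
  also have "\<dots> = local_param \<beta>"
  proof -
    obtain a d where *: "a > 0" "d > 0" "gram n x 1 1 = a\<^sup>2" "gram_det n x = d\<^sup>2" "sigma_beta n x = a / d"
      using gram_roots by blast
    show ?thesis
      unfolding local_param_def * using *(1,2) by (simp add: real_sqrt_mult power2_eq_square field_simps)
  qed
  finally show ?thesis .
qed

text \<open>This is the standardised omitted-variable bias of the restricted estimator.\<close>

lemma sum_wW_mean:
  "(\<Sum>t=1..n. wW t * (\<alpha> * x t $ 1 + \<beta> * x t $ 2)) - sqrt (real n) * \<alpha> * sqrt (gram n x 1 1)
    = - rho n x * local_param \<beta> / sqrt (1 - (rho n x)\<^sup>2)"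
proof -
  have "(\<Sum>t=1..n. wW t * (\<alpha> * x t $ 1 + \<beta> * x t $ 2)) =
      sqrt (real n) * (\<alpha> * (gram n x 1 1 / sqrt (gram n x 1 1)) + \<beta> * gram n x 1 2 / sqrt (gram n x 1 1))"
    unfolding sum_wW cross_lin cross_x by (simp add: algebra_simps add_divide_distrib)
  also have "gram n x 1 1 / sqrt (gram n x 1 1) = sqrt (gram n x 1 1)"
    using gram_11_pos by (simp add: real_div_sqrt)
  finally have "(\<Sum>t=1..n. wW t * (\<alpha> * x t $ 1 + \<beta> * x t $ 2)) - sqrt (real n) * \<alpha> * sqrt (gram n x 1 1)
      = sqrt (real n) * \<beta> * gram n x 1 2 / sqrt (gram n x 1 1)"
    by (simp add: algebra_simps)
  also have "\<dots> = - rho n x * local_param \<beta> / sqrt (1 - (rho n x)\<^sup>2)"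
  proof -
    obtain a b d where *: "a > 0" "b > 0" "d > 0" "gram n x 1 1 = a\<^sup>2" "sigma_beta n x = a / d"
        "sqrt (1 - (rho n x)\<^sup>2) = d / (a * b)" and r: "rho n x = - gram n x 1 2 / (a * b)"
      using gram_roots by blast
    show ?thesis
      unfolding local_param_def * unfolding r using *(1-3) by (simp add: power2_eq_square field_simps)
  qed
  finally show ?thesis .
qed

text \<open>The pair (V, W) recovered from the data at given parameters. Being a function of the
  data, it can be pushed forward under \<open>P\<close>.\<close>

definition noise :: "real \<Rightarrow> real \<Rightarrow> (nat \<Rightarrow> real) \<Rightarrow> real \<times> real" where
  "noise \<alpha> \<beta> y = (\<Sum>t=1..n. wV t * (y t - (\<alpha> * x t $ 1 + \<beta> * x t $ 2)),
                \<Sum>t=1..n. wW t * (y t - (\<alpha> * x t $ 1 + \<beta> * x t $ 2)))"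

lemma std_beta_noise: "std_beta y = local_param \<beta> + fst (noise \<alpha> \<beta> y)"
  using sum_wV_mean[of \<alpha> \<beta>]
  by (simp add: std_beta_eq noise_def right_diff_distrib sum_subtractf)

lemma T_stat_noise:
  assumes "pretest c (rho n x)"
  shows "T_stat n x c \<alpha> y = pretest.T c (rho n x) (local_param \<beta>) (fst (noise \<alpha> \<beta> y)) (snd (noise \<alpha> \<beta> y))"
proof -
  interpret pretest c "rho n x" by (rule assms)
  have R: "(\<Sum>t=1..n. wW t * y t) - sqrt (real n) * \<alpha> * sqrt (gram n x 1 1)
      = snd (noise \<alpha> \<beta> y) - rho n x * local_param \<beta> / s"
    using sum_wW_mean[of \<alpha> \<beta>] by (simp add: noise_def right_diff_distrib sum_subtractf s_def)
  show ?thesis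
    \<comment> \<open>In the unrestricted branch the bias, multiplied by \<open>s\<close>, cancels
      \<rho> times the local parameter, leaving \<rho> * V + s * W.\<close>
    unfolding T_stat_eq R std_beta_noise[of y \<beta> \<alpha>] T_def s_def[symmetric] Let_def
    using s_pos by (simp add: field_simps)
qed

lemma measurable_noise [measurable]:
  "noise \<alpha> \<beta> \<in> PiM {1..n} (\<lambda>_. borel) \<rightarrow>\<^sub>M borel \<Otimes>\<^sub>M borel"
  unfolding noise_def by measurable

end

section \<open>The law of the data and the reduction to the standardised problem\<close>

locale gaussian_regression = full_rank_design n x + pretest c "rho n x" + prob_space M
  for n x c and M :: "'a measure" +
  fixes \<epsilon> :: "nat \<Rightarrow> 'a \<Rightarrow> real" and P :: "real \<Rightarrow> real \<Rightarrow> (nat \<Rightarrow> real) measure"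
  assumes err_indep: "indep_vars (\<lambda>_. borel) \<epsilon> {1..n}"
    and err_normal: "\<And>t. t \<in> {1..n} \<Longrightarrow> distributed M lborel (\<epsilon> t) std_normal_density"
    and data_law: "\<And>\<alpha> \<beta>. P \<alpha> \<beta> = distr M (PiM {1..n} (\<lambda>_. borel))
            (\<lambda>\<omega>. \<lambda>t\<in>{1..n}. \<alpha> * x t $ 1 + \<beta> * x t $ 2 + \<epsilon> t \<omega>)"
begin

lemma measurable_err: "t \<in> {1..n} \<Longrightarrow> \<epsilon> t \<in> borel_measurable M"
  using distributed_measurable[OF err_normal] by simp

lemma measurable_data [measurable]:
  "(\<lambda>\<omega>. \<lambda>t\<in>{1..n}. \<alpha> * x t $ 1 + \<beta> * x t $ 2 + \<epsilon> t \<omega>) \<in> M \<rightarrow>\<^sub>M PiM {1..n} (\<lambda>_. borel)"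
  by (intro measurable_restrict borel_measurable_add borel_measurable_const measurable_err)

lemma sets_P [measurable_cong]: "sets (P \<alpha> \<beta>) = sets (PiM {1..n} (\<lambda>_. borel))"
  by (simp add: data_law)

lemma prob_space_P: "prob_space (P \<alpha> \<beta>)"
  unfolding data_law by (rule prob_space_distr[OF measurable_data])

lemma measurable_noise_P [measurable]: "noise \<alpha>' \<beta>' \<in> P \<alpha> \<beta> \<rightarrow>\<^sub>M borel \<Otimes>\<^sub>M borel"
  by (subst measurable_cong_sets[OF sets_P refl]) (rule measurable_noise)

lemma distr_noise: "distr (P \<alpha> \<beta>) (borel \<Otimes>\<^sub>M borel) (noise \<alpha> \<beta>) = N01 \<Otimes>\<^sub>M N01"
proof -
  have "distr (P \<alpha> \<beta>) (borel \<Otimes>\<^sub>M borel) (noise \<alpha> \<beta>)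
      = distr M (borel \<Otimes>\<^sub>M borel) (\<lambda>\<omega>. (\<Sum>t=1..n. wV t * \<epsilon> t \<omega>, \<Sum>t=1..n. wW t * \<epsilon> t \<omega>))"
    unfolding data_law distr_distr[OF measurable_noise measurable_data]
    by (intro distr_cong refl) (simp add: noise_def)
  also have "\<dots> = N01 \<Otimes>\<^sub>M N01"
    by (rule distr_orthonormal_combinations_std_normal[OF _ err_indep err_normal orthonormal_weights]) auto
  finally show ?thesis .
qed

lemma H_cdf_eq: "H_cdf P n x c \<alpha> \<beta> = H (local_param \<beta>)"
proof -
  have "distr (P \<alpha> \<beta>) borel (T_stat n x c \<alpha>)
      = distr (P \<alpha> \<beta>) borel ((\<lambda>p. T (local_param \<beta>) (fst p) (snd p)) \<circ> noise \<alpha> \<beta>)"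
    by (intro distr_cong refl) (simp add: T_stat_noise[OF pretest_axioms, of _ _ \<beta>])
  also have "\<dots> = distr (N01 \<Otimes>\<^sub>M N01) borel (\<lambda>p. T (local_param \<beta>) (fst p) (snd p))"
    unfolding distr_noise[of \<alpha> \<beta>, symmetric] by (rule distr_distr[symmetric]) simp_all
  finally show ?thesis by (simp add: H_cdf_def cdf_T)
qed

lemma crit_eq: "crit P n x c \<alpha> \<beta> v = q v (local_param \<beta>)"
  by (simp add: crit_def H_cdf_eq q_def)

lemma local_param_beta_U: "local_param (beta_U n x y) = std_beta y"
  by (simp add: local_param_def std_beta_def)

lemma local_param_eq_mult: "local_param = (*) (sqrt (real n) / sigma_beta n x)"
  by (auto simp: local_param_def)

lemma local_param_surj: "\<exists>\<beta>. local_param \<beta> = g"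
  using n_pos sigma_beta_pos by (intro exI[of _ "g * sigma_beta n x / sqrt (real n)"]) (simp add: local_param_def)

lemma crit_sup_eq: "crit_sup P n x c \<alpha> \<delta> = (SUP g. q \<delta> g)"
proof -
  have "range local_param = UNIV" using local_param_surj by (auto simp: image_iff) metis
  then have "range (\<lambda>\<beta>. q \<delta> (local_param \<beta>)) = range (q \<delta>)"
    by (metis image_image)
  then show ?thesis by (simp add: crit_sup_def crit_eq)
qed

text \<open>Rescaling maps the confidence interval to a window around the standardised estimator
  whose half-width is the normal quantile alone, so \<open>n\<close> and the variance
  cancel.\<close>

lemma crit_Loh_eq: "crit_Loh P n x c \<alpha> \<eta> \<delta> y = loh (std_normal_quantile (1 - \<eta> / 2)) (\<delta> - \<eta>) (std_beta y)"
proof -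
  let ?w = "std_normal_quantile (1 - \<eta> / 2)"
  have "local_param ` conf_int n x \<eta> y = {std_beta y - ?w..std_beta y + ?w}"
  proof -
    have "sqrt (real n) / sigma_beta n x > 0" using n_pos sigma_beta_pos by simp
    then have "local_param ` conf_int n x \<eta> y =
       {local_param (beta_U n x y - sigma_beta n x / sqrt (real n) * ?w)..
        local_param (beta_U n x y + sigma_beta n x / sqrt (real n) * ?w)}"
      unfolding local_param_eq_mult conf_int_def
      by (subst image_mult_atLeastAtMost) auto
    also have "\<dots> = {std_beta y - ?w..std_beta y + ?w}"
      using n_pos sigma_beta_pos by (simp add: local_param_def std_beta_def field_simps)
    finally show ?thesis .
  qed
  then show ?thesis
    by (simp add: crit_Loh_def loh_def crit_eq flip: image_image[of "q (\<delta> - \<eta>)" local_param])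
qed

text \<open>Any critical value that depends on the data only through the standardised estimator has,
  at the \<beta> corresponding to \<open>g\<close>, the rejection probability of the two-normal
  problem. In this lower bound the design enters only through \<open>rho n x\<close>.\<close>

lemma SUP_rejection_prob_ge:
  assumes k: "k \<in> borel_measurable borel" and C: "\<And>y. C y = k (std_beta y)"
  shows "measure (N01 \<Otimes>\<^sub>M N01) {p. k (g + fst p) < T g (fst p) (snd p)}
    \<le> (SUP \<beta>. measure (P \<alpha> \<beta>) {y \<in> space (P \<alpha> \<beta>). T_stat n x c \<alpha> y > C y})"
proof -
  obtain \<beta> where g: "local_param \<beta> = g" using local_param_surj by blast
  have "{p \<in> space (borel \<Otimes>\<^sub>M borel). k (g + fst p) < T g (fst p) (snd p)} \<in> sets (borel \<Otimes>\<^sub>M borel)"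
    using k by measurable
  then have E: "{p. k (g + fst p) < T g (fst p) (snd p)} \<in> sets (borel \<Otimes>\<^sub>M borel)"
    by (simp add: space_pair_measure)
  have "measure (N01 \<Otimes>\<^sub>M N01) {p. k (g + fst p) < T g (fst p) (snd p)}
      = measure (P \<alpha> \<beta>) (noise \<alpha> \<beta> -` {p. k (g + fst p) < T g (fst p) (snd p)} \<inter> space (P \<alpha> \<beta>))"
    unfolding distr_noise[of \<alpha> \<beta>, symmetric] by (rule measure_distr[OF _ E]) simp
  also have "\<dots> = measure (P \<alpha> \<beta>) {y \<in> space (P \<alpha> \<beta>). T_stat n x c \<alpha> y > C y}"
    by (rule arg_cong[where f = "measure (P \<alpha> \<beta>)"])
       (auto simp: C T_stat_noise[OF pretest_axioms, of _ _ \<beta>] std_beta_noise[of _ \<beta> \<alpha>] g)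
  also have "\<dots> \<le> (SUP \<beta>. measure (P \<alpha> \<beta>) {y \<in> space (P \<alpha> \<beta>). T_stat n x c \<alpha> y > C y})"
    using prob_space.prob_le_1[OF prob_space_P] by (intro cSUP_upper) (auto intro!: bdd_aboveI2[where M = 1])
  finally show ?thesis .
qed

end

section \<open>Uniformity over the sample size\<close>

lemma std_normal_quantile_nonneg:
  assumes "0 < p" "p < 1" "1 / 2 \<le> p" shows "std_normal_quantile p \<ge> 0"
proof -
  have "mixture (\<lambda>_. 1) (\<lambda>_. 0) (std_normal_quantile p) = p"
    unfolding std_normal_quantile_def \<Phi>_eq_mixture using assms by (intro mixture_inv) auto
  then have "\<Phi> 0 \<le> \<Phi> (std_normal_quantile p)"
    using assms by (simp add: \<Phi>_zero flip: \<Phi>_eq_mixture)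
  then show ?thesis by (simp only: \<Phi>_le_iff)
qed

theorem theorem2:
  fixes M :: "nat \<Rightarrow> 'a measure"
    and \<epsilon> :: "nat \<Rightarrow> nat \<Rightarrow> 'a \<Rightarrow> real"
    and X :: "nat \<Rightarrow> nat \<Rightarrow> real^2"
    and Q :: "real^2^2"
    and P :: "nat \<Rightarrow> real \<Rightarrow> real \<Rightarrow> (nat \<Rightarrow> real) measure"
    and c \<alpha>\<^sub>0 \<rho> \<delta> :: real
  assumes prob: "\<And>n. n > 1 \<Longrightarrow> prob_space (M n)"
    and err_indep: "\<And>n. n > 1 \<Longrightarrow> prob_space.indep_vars (M n) (\<lambda>_. borel) (\<epsilon> n) {1..n}"
    and err_normal: "\<And>n t. n > 1 \<Longrightarrow> t \<in> {1..n} \<Longrightarrow>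
          distributed (M n) lborel (\<epsilon> n t) std_normal_density"
    and data_law: "\<And>n \<alpha> \<beta>. n > 1 \<Longrightarrow>
          P n \<alpha> \<beta> = distr (M n) (PiM {1..n} (\<lambda>_. borel))
            (\<lambda>\<omega>. \<lambda>t\<in>{1..n}. \<alpha> * X n t $ 1 + \<beta> * X n t $ 2 + \<epsilon> n t \<omega>)"
    and full_rank: "\<And>n. n > 1 \<Longrightarrow> design_rank n (X n) = 2"
    and gram_lim: "(\<lambda>n. scaled_gram n (X n)) \<longlonglongrightarrow> Q"
    and Q_pos: "positive_definite Q"
    and c_pos: "c > 0"
    and rho_const: "\<And>n. n > 1 \<Longrightarrow> rho n (X n) = \<rho>"
    and rho_nz: "\<rho> \<noteq> 0"
    and delta: "0 < \<delta>" "\<delta> \<le> 1/2"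
  shows "(INF n\<in>{1<..}. SUP \<beta>. measure (P n \<alpha>\<^sub>0 \<beta>)
            {y \<in> space (P n \<alpha>\<^sub>0 \<beta>).
               T_stat n (X n) c \<alpha>\<^sub>0 y > crit (P n) n (X n) c \<alpha>\<^sub>0 (beta_U n (X n) y) \<delta>}) > \<delta>
       \<and> (\<exists>\<eta>\<^sub>0\<in>{0<..<\<delta>}. \<forall>\<eta>\<in>{0<..<\<eta>\<^sub>0}.
            (INF n\<in>{1<..}. SUP \<beta>. measure (P n \<alpha>\<^sub>0 \<beta>)
              {y \<in> space (P n \<alpha>\<^sub>0 \<beta>).
                 T_stat n (X n) c \<alpha>\<^sub>0 y > crit_min (P n) n (X n) c \<alpha>\<^sub>0 \<eta> \<delta> y}) > \<delta>)"
proof -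
  have design: "full_rank_design n (X n)" if "n > 1" for n
    using that full_rank by (simp add: full_rank_design_def)
  \<comment> \<open>The instance n = 2 of the constant correlation supplies \<bar>\<rho>\<bar> <
    1.\<close>
  interpret pretest c \<rho>
    using full_rank_design.abs_rho_less_1[OF design[of 2]] c_pos rho_nz rho_const[of 2]
    by (simp add: pretest_def)
  have model: "gaussian_regression n (X n) c (M n) (\<epsilon> n) (P n)" if "n > 1" for n
    using design[OF that] prob[OF that] err_indep[OF that] err_normal[OF that] data_law[OF that]
      pretest_axioms rho_const[OF that]
    by (simp add: gaussian_regression_def gaussian_regression_axioms_def)
  have d: "0 < \<delta>" "\<delta> < 1" using delta by auto
  show ?thesis
  proof (intro conjI)
    \<comment> \<open>This \<open>g\<close> is fixed before \<open>n\<close>, and each sample size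
      realises it by its own \<beta>. One strict bound therefore serves all \<open>n\<close> and
      survives the infimum.\<close>
    obtain g where g: "\<delta> < measure (N01 \<Otimes>\<^sub>M N01) {p. q \<delta> (g + fst p) < T g (fst p) (snd p)}"
      using plug_in_rejection_prob_gt[OF delta] by blast
    also have "\<dots> \<le> (INF n\<in>{1<..}. SUP \<beta>. measure (P n \<alpha>\<^sub>0 \<beta>)
            {y \<in> space (P n \<alpha>\<^sub>0 \<beta>).
               T_stat n (X n) c \<alpha>\<^sub>0 y > crit (P n) n (X n) c \<alpha>\<^sub>0 (beta_U n (X n) y) \<delta>})"
    proof (rule cINF_greatest)
      fix n :: nat assume "n \<in> {1<..}"
      then have n: "n > 1" by simp
      interpret G: gaussian_regression n "X n" c "M n" "\<epsilon> n" "P n" by (rule model[OF n])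
      show "measure (N01 \<Otimes>\<^sub>M N01) {p. q \<delta> (g + fst p) < T g (fst p) (snd p)}
        \<le> (SUP \<beta>. measure (P n \<alpha>\<^sub>0 \<beta>) {y \<in> space (P n \<alpha>\<^sub>0 \<beta>).
               T_stat n (X n) c \<alpha>\<^sub>0 y > crit (P n) n (X n) c \<alpha>\<^sub>0 (beta_U n (X n) y) \<delta>})"
        using d by (intro G.SUP_rejection_prob_ge[unfolded rho_const[OF n]]) (auto simp: G.crit_eq G.local_param_beta_U rho_const[OF n])
    qed auto
    finally show "(INF n\<in>{1<..}. SUP \<beta>. measure (P n \<alpha>\<^sub>0 \<beta>)
            {y \<in> space (P n \<alpha>\<^sub>0 \<beta>).
               T_stat n (X n) c \<alpha>\<^sub>0 y > crit (P n) n (X n) c \<alpha>\<^sub>0 (beta_U n (X n) y) \<delta>}) > \<delta>" .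
  next
    obtain \<eta>\<^sub>0 g where \<eta>\<^sub>0: "0 < \<eta>\<^sub>0" "\<eta>\<^sub>0 < \<delta>"
      and g: "\<And>\<eta> w. 0 < \<eta> \<Longrightarrow> \<eta> < \<eta>\<^sub>0 \<Longrightarrow> 0 \<le> w \<Longrightarrow> \<delta> < measure (N01 \<Otimes>\<^sub>M N01)
        {p. min (SUP g'. q \<delta> g') (loh w (\<delta> - \<eta>) (g + fst p)) < T g (fst p) (snd p)}"
      using min_rejection_prob_gt[OF delta] by blast
    show "\<exists>\<eta>\<^sub>0\<in>{0<..<\<delta>}. \<forall>\<eta>\<in>{0<..<\<eta>\<^sub>0}.
            (INF n\<in>{1<..}. SUP \<beta>. measure (P n \<alpha>\<^sub>0 \<beta>)
              {y \<in> space (P n \<alpha>\<^sub>0 \<beta>).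
                 T_stat n (X n) c \<alpha>\<^sub>0 y > crit_min (P n) n (X n) c \<alpha>\<^sub>0 \<eta> \<delta> y}) > \<delta>"
    proof (intro bexI[of _ \<eta>\<^sub>0] ballI)
      fix \<eta> assume "\<eta> \<in> {0<..<\<eta>\<^sub>0}"
      then have \<eta>: "0 < \<eta>" "\<eta> < \<eta>\<^sub>0" by auto
      define w where "w = std_normal_quantile (1 - \<eta> / 2)"
      \<comment> \<open>A nonnegative half-width makes the window nonempty.\<close>
      have w: "w \<ge> 0" unfolding w_def using \<eta> \<eta>\<^sub>0 delta by (intro std_normal_quantile_nonneg) auto
      have "\<delta> < measure (N01 \<Otimes>\<^sub>M N01)
        {p. min (SUP g'. q \<delta> g') (loh w (\<delta> - \<eta>) (g + fst p)) < T g (fst p) (snd p)}"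
        by (rule g[OF \<eta> w])
      also have "\<dots> \<le> (INF n\<in>{1<..}. SUP \<beta>. measure (P n \<alpha>\<^sub>0 \<beta>)
              {y \<in> space (P n \<alpha>\<^sub>0 \<beta>).
                 T_stat n (X n) c \<alpha>\<^sub>0 y > crit_min (P n) n (X n) c \<alpha>\<^sub>0 \<eta> \<delta> y})"
      proof (rule cINF_greatest)
        fix n :: nat assume "n \<in> {1<..}"
        then have n: "n > 1" by simp
        interpret G: gaussian_regression n "X n" c "M n" "\<epsilon> n" "P n" by (rule model[OF n])
        have "loh w (\<delta> - \<eta>) \<in> borel_measurable borel"
          using \<eta> \<eta>\<^sub>0 delta w by (intro measurable_loh) auto
        then show "measure (N01 \<Otimes>\<^sub>M N01)
              {p. min (SUP g'. q \<delta> g') (loh w (\<delta> - \<eta>) (g + fst p)) < T g (fst p) (snd p)}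
          \<le> (SUP \<beta>. measure (P n \<alpha>\<^sub>0 \<beta>) {y \<in> space (P n \<alpha>\<^sub>0 \<beta>).
                 T_stat n (X n) c \<alpha>\<^sub>0 y > crit_min (P n) n (X n) c \<alpha>\<^sub>0 \<eta> \<delta> y})"
          by (intro G.SUP_rejection_prob_ge[unfolded rho_const[OF n], where k = "\<lambda>u. min (SUP g'. q \<delta> g') (loh w (\<delta> - \<eta>) u)"])
             (auto simp: crit_min_def G.crit_sup_eq G.crit_Loh_eq rho_const[OF n] w_def)
      qed auto
      finally show "(INF n\<in>{1<..}. SUP \<beta>. measure (P n \<alpha>\<^sub>0 \<beta>)
              {y \<in> space (P n \<alpha>\<^sub>0 \<beta>).
                 T_stat n (X n) c \<alpha>\<^sub>0 y > crit_min (P n) n (X n) c \<alpha>\<^sub>0 \<eta> \<delta> y}) > \<delta>" .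
    qed (use \<eta>\<^sub>0 in auto)
  qed
qed

end
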